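(* Let $1<q<\infty$ and let $\lambda,\mu,\nu,\alpha$ be real numbers. Then $H_{\lambda,\mu,\nu}$ is bounded from $L^q_\alpha$ to $L^\infty$ if and only if $$\lambda=\mu+\nu+1-\frac{\alpha+1}{q}\quad\text{and}\quad q(\mu+1-\lambda)<\alpha+1<q(\mu+1),$$ or equivalently, if and only if $$\lambda=\mu+\nu+1-\frac{\alpha+1}{q}\quad\text{and}\quad 0<\nu<\lambda.$$
   Context: Let $p$ be a prime, $\mathbb{Q}_p$ the field of $p$-adic numbers with its norm $|\cdot|_p$ (so $|p|_p=p^{-1}$), $\mathbb{Q}_p^*=\mathbb{Q}_p\setminus\{0\}$, and $dx$ the Haar measure on $\mathbb{Q}_p$ normalized so that $\{x:|x|_p\leq 1\}$ has measure $1$. For $1\leq q<\infty$ and $\alpha\in\mathbb{R}$, $L^q_\alpha$ is the space of real-valued measurable functions $f$ on $\mathbb{Q}_p^*$ with $\|f\|_{q,\alpha}=\left[\int_{\mathbb{Q}_p^*}|f(x)|^q|x|_p^\alpha\,dx\right]^{1/q}<\infty$; $L^\infty$ is the space of real-valued measurable functions on $\mathbb{Q}_p^*$ with finite essential supremum norm $\|f\|_\infty$. For real $\lambda,\mu,\nu$ and a real-valued measurable $f$ on $\mathbb{Q}_p^*$, $$H_{\lambda,\mu,\nu}f(y)=\int_{\mathbb{Q}_p^*}\frac{|x|_p^\mu|y|_p^\nu}{[\max\{|x|_p,|y|_p\}]^\lambda}f(x)\,dx,\qquad y\in\mathbb{Q}_p^*.$$ "Bounded from $X$ to $Y$" means that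 for every $f\in X$ the integral converges absolutely for almost every $y$ and there is a constant $C$ with $\|H_{\lambda,\mu,\nu}f\|_Y\leq C\|f\|_X$ for all $f\in X$. *)

theory Defs
  imports "HOL-Probability.Essential_Supremum" "HOL-Computational_Algebra.Primes"
begin

subsection \<open>The fields of p-adic numbers\<close>

text \<open>
  As the dimension of \<open>real ^ 'n\<close> is given by the index type \<open>'n\<close>, the prime \<open>p\<close> of the field
  \<open>'p padic\<close> of \<open>p\<close>-adic numbers is the cardinality of the index type \<open>'p\<close>.
\<close>

class prime_card = finite +
  assumes prime_card: "prime CARD('a)"

definition rat_padic_abs :: "nat \<Rightarrow> rat \<Rightarrow> real" where
  "rat_padic_abs p x = (if x = 0 then 0 else
     real p powi (int (multiplicity (int p) (snd (quotient_of x)))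
                - int (multiplicity (int p) (fst (quotient_of x)))))"

lemma multiplicity_minus_right': "multiplicity p (- x :: int) = multiplicity p x"
  using multiplicity_times_unit_right[of "-1 :: int" p x] by simp

lemma rat_padic_abs_0 [simp]: "rat_padic_abs p 0 = 0"
  by (simp add: rat_padic_abs_def)

lemma rat_padic_abs_fraction:
  assumes p: "prime p" and a: "a \<noteq> 0" and b: "b \<noteq> 0"
  shows "rat_padic_abs p (of_int a / of_int b) =
    real p powi (int (multiplicity (int p) b) - int (multiplicity (int p) a))"
proof -
  define x :: rat where "x = of_int a / of_int b"
  obtain c d where cd: "quotient_of x = (c, d)" by (cases "quotient_of x")
  have d: "d > 0" using cd quotient_of_denom_pos by blast
  have x: "x = of_int c / of_int d" using cd quotient_of_div by blast
  have x0: "x \<noteq> 0" using a b by (simp add: x_def)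
  have c: "c \<noteq> 0" using x0 x by auto
  have "(of_int (a * d) :: rat) = of_int (c * b)"
    using x x_def b d by (simp add: field_simps)
  hence eq: "a * d = c * b" using of_int_eq_iff by blast
  have pe: "prime_elem (int p)" using p by simp
  have "multiplicity (int p) a + multiplicity (int p) d = multiplicity (int p) c + multiplicity (int p) b"
    using prime_elem_multiplicity_mult_distrib[OF pe] a b c d eq by (metis less_irrefl)
  hence "int (multiplicity (int p) d) - int (multiplicity (int p) c) =
         int (multiplicity (int p) b) - int (multiplicity (int p) a)" by linarith
  thus ?thesis using x0 cd by (simp add: rat_padic_abs_def x_def[symmetric])
qed

lemma rat_fractionE:
  obtains a b :: int where "x = (of_int a / of_int b :: rat)" "b > 0"
  by (metis quotient_of_denom_pos quotient_of_div surj_pair)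

lemma rat_padic_abs_nonneg [simp]: "rat_padic_abs p x \<ge> 0"
  by (simp add: rat_padic_abs_def)

lemma rat_padic_abs_eq_0_iff [simp]: "prime p \<Longrightarrow> rat_padic_abs p x = 0 \<longleftrightarrow> x = 0"
  by (auto simp: rat_padic_abs_def dest: prime_gt_0_nat)

lemma rat_padic_abs_mult:
  assumes p: "prime p"
  shows "rat_padic_abs p (x * y) = rat_padic_abs p x * rat_padic_abs p y"
proof (cases "x = 0 \<or> y = 0")
  case False
  obtain a b where x: "x = of_int a / of_int b" "b > 0" by (rule rat_fractionE)
  obtain c d where y: "y = of_int c / of_int d" "d > 0" by (rule rat_fractionE)
  have nz: "a \<noteq> 0" "b \<noteq> 0" "c \<noteq> 0" "d \<noteq> 0" using False x y by auto
  have xy: "x * y = of_int (a * c) / of_int (b * d)" using x y by simp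
  have pe: "prime_elem (int p)" using p by simp
  have p0: "real p \<noteq> 0" using p by auto
  show ?thesis
    unfolding xy rat_padic_abs_fraction[OF p no_zero_divisors[OF nz(1,3)] no_zero_divisors[OF nz(2,4)]]
    unfolding x(1) y(1) rat_padic_abs_fraction[OF p nz(1,2)] rat_padic_abs_fraction[OF p nz(3,4)]
      prime_elem_multiplicity_mult_distrib[OF pe nz(1,3)] prime_elem_multiplicity_mult_distrib[OF pe nz(2,4)]
      power_int_add[OF disjI1[OF p0], symmetric] by (simp add: algebra_simps)
qed auto

lemma rat_padic_abs_int_le_iff:
  assumes p: "prime p"
  shows "rat_padic_abs p (of_int a) \<le> 1 / real p ^ n \<longleftrightarrow> int p ^ n dvd a"
proof (cases "a = 0")
  case False
  have p1: "real p > 1" using p prime_gt_1_nat by auto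
  have "rat_padic_abs p (of_int a) = real p powi (- int (multiplicity (int p) a))"
    using rat_padic_abs_fraction[OF p False, of 1] by simp
  also have "\<dots> = 1 / real p ^ multiplicity (int p) a"
    by (simp add: power_int_minus field_simps)
  finally have "rat_padic_abs p (of_int a) \<le> 1 / real p ^ n \<longleftrightarrow> real p ^ n \<le> real p ^ multiplicity (int p) a"
    using p1 by (simp add: divide_le_eq le_divide_eq)
  hence "rat_padic_abs p (of_int a) \<le> 1 / real p ^ n \<longleftrightarrow> n \<le> multiplicity (int p) a"
    using p1 by simp
  moreover have "int p ^ n dvd a \<longleftrightarrow> n \<le> multiplicity (int p) a"
    using p False by (intro power_dvd_iff_le_multiplicity) auto
  ultimately show ?thesis by simp
qed auto

lemma rat_padic_abs_int_le_1: "prime p \<Longrightarrow> rat_padic_abs p (of_int a) \<le> 1"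
  using rat_padic_abs_int_le_iff[of p a 0] by simp

lemma rat_padic_abs_p: "prime p \<Longrightarrow> rat_padic_abs p (of_nat p) = 1 / real p"
  using rat_padic_abs_fraction[of p "int p" 1] prime_gt_0_nat[of p]
  by (simp add: field_simps power_int_minus)

lemma rat_padic_abs_1 [simp]: "rat_padic_abs p 1 = 1"
  by (simp add: rat_padic_abs_def)

lemma rat_padic_abs_minus [simp]: "rat_padic_abs p (- x) = rat_padic_abs p x"
  by (simp add: rat_padic_abs_def rat_uminus_code Let_def multiplicity_minus_right' split: prod.split)

lemma rat_padic_abs_minus_commute: "rat_padic_abs p (x - y) = rat_padic_abs p (y - x)"
  by (metis minus_diff_eq rat_padic_abs_minus)

lemma rat_padic_abs_inverse:
  assumes p: "prime p" shows "rat_padic_abs p (inverse x) = inverse (rat_padic_abs p x)"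
proof (cases "x = 0")
  case False
  hence "rat_padic_abs p x * rat_padic_abs p (inverse x) = 1"
    by (simp add: rat_padic_abs_mult[OF p, symmetric])
  thus ?thesis by (metis inverse_unique)
qed auto

lemma rat_padic_abs_power: "prime p \<Longrightarrow> rat_padic_abs p (x ^ n) = rat_padic_abs p x ^ n"
  by (induction n) (auto simp: rat_padic_abs_mult)

lemma rat_padic_abs_le_1E:
  assumes p: "prime p" and le: "rat_padic_abs p u \<le> 1"
  obtains a b where "u = of_int a / of_int b" "b > 0" "\<not> int p dvd b" "rat_padic_abs p (of_int b) = 1"
proof -
  obtain a b where ab: "quotient_of u = (a, b)" by (cases "quotient_of u")
  have b: "b > 0" using ab quotient_of_denom_pos by blast
  have u: "u = of_int a / of_int b" using ab quotient_of_div by blast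
  have cop: "coprime a b" using ab quotient_of_coprime by blast
  have nb: "\<not> int p dvd b"
  proof
    assume d: "int p dvd b"
    hence na: "\<not> int p dvd a" using cop p
      by (metis coprime_common_divisor not_prime_unit prime_nat_int_transfer)
    hence a0: "a \<noteq> 0" by auto
    have "multiplicity (int p) b \<ge> 1" using d b p
      by (metis One_nat_def less_irrefl not_prime_unit power_one_right multiplicity_geI prime_nat_int_transfer)
    moreover have "multiplicity (int p) a = 0" using na by (rule not_dvd_imp_multiplicity_0)
    ultimately have "rat_padic_abs p u = real p powi (int (multiplicity (int p) b))" 
      using rat_padic_abs_fraction[OF p a0, of b] b u by simp
    also have "\<dots> > 1" using \<open>multiplicity (int p) b \<ge> 1\<close> prime_gt_1_nat[OF p] by simp
    finally show False using le by simp
  qed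
  have vb: "rat_padic_abs p (of_int b) = 1"
    using rat_padic_abs_fraction[OF p, of b 1] b not_dvd_imp_multiplicity_0[OF nb] by simp
  show thesis using that u b nb vb by blast
qed

lemma rat_padic_abs_ultra:
  assumes p: "prime p"
  shows "rat_padic_abs p (x + y) \<le> max (rat_padic_abs p x) (rat_padic_abs p y)"
proof -
  have *: "rat_padic_abs p (x + y) \<le> rat_padic_abs p x" if le: "rat_padic_abs p y \<le> rat_padic_abs p x" for x y
  proof (cases "x = 0")
    case False
    define u where "u = y / x"
    have vx: "rat_padic_abs p x > 0" using False p by (simp add: order_less_le)
    have "rat_padic_abs p u \<le> 1"
    proof -
      have "rat_padic_abs p u = rat_padic_abs p y / rat_padic_abs p x"
        unfolding u_def divide_inverse rat_padic_abs_mult[OF p] rat_padic_abs_inverse[OF p] ..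
      thus ?thesis using le vx by simp
    qed
    then obtain a b where u: "u = of_int a / of_int b" and b: "b > 0" and vb: "rat_padic_abs p (of_int b) = 1"
      by (rule rat_padic_abs_le_1E[OF p])
    have "1 + u = of_int (b + a) * inverse (of_int b)" using b u by (simp add: field_simps)
    hence "rat_padic_abs p (1 + u) \<le> 1"
      using rat_padic_abs_int_le_1[OF p, of "b + a"]
      by (simp add: rat_padic_abs_mult[OF p] rat_padic_abs_inverse[OF p] vb)
    moreover have "x + y = x * (1 + u)" using False by (simp add: u_def field_simps)
    ultimately show ?thesis using vx by (simp add: rat_padic_abs_mult[OF p])
  qed (use le in auto)
  show ?thesis
    using *[of y x] *[of x y] by (auto simp: max_def add.commute)
qed

lemma rat_padic_abs_ultra_diff:
  "prime p \<Longrightarrow> rat_padic_abs p (x - y) \<le> max (rat_padic_abs p x) (rat_padic_abs p y)"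
  using rat_padic_abs_ultra[of p x "- y"] by simp

lemma rat_padic_abs_triangle:
  "prime p \<Longrightarrow> rat_padic_abs p (x + y) \<le> rat_padic_abs p x + rat_padic_abs p y"
  using rat_padic_abs_ultra[of p x y] rat_padic_abs_nonneg[of p x] rat_padic_abs_nonneg[of p y] by linarith

lemma rat_padic_abs_reverse_triangle:
  "prime p \<Longrightarrow> \<bar>rat_padic_abs p x - rat_padic_abs p y\<bar> \<le> rat_padic_abs p (x - y)"
  using rat_padic_abs_triangle[of p "x - y" y] rat_padic_abs_triangle[of p "y - x" x]
  by (auto simp: rat_padic_abs_minus_commute[of p y x])

definition padic_cauchy :: "nat \<Rightarrow> (nat \<Rightarrow> rat) \<Rightarrow> bool" where
  "padic_cauchy p X \<longleftrightarrow> (\<forall>e>0. \<exists>N. \<forall>m\<ge>N. \<forall>n\<ge>N. rat_padic_abs p (X m - X n) < e)"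

definition padic_vanishes :: "nat \<Rightarrow> (nat \<Rightarrow> rat) \<Rightarrow> bool" where
  "padic_vanishes p X \<longleftrightarrow> (\<lambda>n. rat_padic_abs p (X n)) \<longlonglongrightarrow> 0"

definition padic_rel :: "nat \<Rightarrow> (nat \<Rightarrow> rat) \<Rightarrow> (nat \<Rightarrow> rat) \<Rightarrow> bool" where
  "padic_rel p X Y \<longleftrightarrow> padic_cauchy p X \<and> padic_cauchy p Y \<and> padic_vanishes p (\<lambda>n. X n - Y n)"

lemma padic_vanishes_le:
  assumes "padic_vanishes p X" "\<And>n. rat_padic_abs p (Y n) \<le> rat_padic_abs p (X n)"
  shows "padic_vanishes p Y"
  using assms unfolding padic_vanishes_def
  by (intro tendsto_sandwich[OF _ _ tendsto_const assms(1)[unfolded padic_vanishes_def]]) auto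

lemma padic_vanishes_minus: "padic_vanishes p X \<Longrightarrow> padic_vanishes p (\<lambda>n. - X n)"
  by (simp add: padic_vanishes_def)

lemma padic_vanishes_add:
  assumes p: "prime p" and "padic_vanishes p X" "padic_vanishes p Y"
  shows "padic_vanishes p (\<lambda>n. X n + Y n)"
  unfolding padic_vanishes_def
proof (rule tendsto_sandwich[OF _ _ tendsto_const])
  show "(\<lambda>n. rat_padic_abs p (X n) + rat_padic_abs p (Y n)) \<longlonglongrightarrow> 0"
    using tendsto_add[OF assms(2,3)[unfolded padic_vanishes_def]] by simp
qed (auto simp: rat_padic_abs_triangle[OF p])

lemma padic_vanishes_diff:
  "prime p \<Longrightarrow> padic_vanishes p X \<Longrightarrow> padic_vanishes p Y \<Longrightarrow> padic_vanishes p (\<lambda>n. X n - Y n)"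
  using padic_vanishes_add[of p X "\<lambda>n. - Y n"] padic_vanishes_minus by simp

lemma padic_cauchy_const [simp]: "padic_cauchy p (\<lambda>_. c)"
  by (simp add: padic_cauchy_def)

lemma padic_cauchy_minus: "padic_cauchy p X \<Longrightarrow> padic_cauchy p (\<lambda>n. - X n)"
  unfolding padic_cauchy_def by (metis minus_diff_minus rat_padic_abs_minus)

lemma padic_cauchy_add:
  assumes p: "prime p" and X: "padic_cauchy p X" and Y: "padic_cauchy p Y"
  shows "padic_cauchy p (\<lambda>n. X n + Y n)"
  unfolding padic_cauchy_def
proof (intro allI impI)
  fix e :: real assume e: "e > 0"
  obtain M where M: "\<And>m n. m \<ge> M \<Longrightarrow> n \<ge> M \<Longrightarrow> rat_padic_abs p (X m - X n) < e"
    using X e unfolding padic_cauchy_def by meson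
  obtain N where N: "\<And>m n. m \<ge> N \<Longrightarrow> n \<ge> N \<Longrightarrow> rat_padic_abs p (Y m - Y n) < e"
    using Y e unfolding padic_cauchy_def by meson
  show "\<exists>N. \<forall>m\<ge>N. \<forall>n\<ge>N. rat_padic_abs p (X m + Y m - (X n + Y n)) < e"
  proof (intro exI[of _ "max M N"] allI impI)
    fix m n assume "m \<ge> max M N" "n \<ge> max M N"
    thus "rat_padic_abs p (X m + Y m - (X n + Y n)) < e"
      using rat_padic_abs_ultra[OF p, of "X m - X n" "Y m - Y n"] M[of m n] N[of m n]
      by (simp add: add_diff_add)
  qed
qed

lemma padic_cauchy_abs:
  assumes p: "prime p" and X: "padic_cauchy p X"
  shows "convergent (\<lambda>n. rat_padic_abs p (X n))"
proof -
  have "Cauchy (\<lambda>n. rat_padic_abs p (X n))"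
  proof (rule metric_CauchyI)
    fix e :: real assume e: "e > 0"
    obtain M where M: "\<And>m n. m \<ge> M \<Longrightarrow> n \<ge> M \<Longrightarrow> rat_padic_abs p (X m - X n) < e"
      using X e unfolding padic_cauchy_def by meson
    show "\<exists>M. \<forall>m\<ge>M. \<forall>n\<ge>M. dist (rat_padic_abs p (X m)) (rat_padic_abs p (X n)) < e"
      using M rat_padic_abs_reverse_triangle[OF p] unfolding dist_real_def by (meson le_less_trans)
  qed
  thus ?thesis by (simp add: Cauchy_convergent_iff)
qed

lemma padic_cauchy_bounded:
  assumes p: "prime p" and X: "padic_cauchy p X"
  obtains B where "B > 0" "\<And>n. rat_padic_abs p (X n) \<le> B"
proof -
  have "Bseq (\<lambda>n. rat_padic_abs p (X n))"
    using padic_cauchy_abs[OF p X] by (rule convergent_imp_Bseq)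
  then obtain K where "K > 0" "\<And>n. norm (rat_padic_abs p (X n)) \<le> K" unfolding Bseq_def by blast
  thus ?thesis using that[of K] by simp
qed

lemma padic_cauchy_mult:
  assumes p: "prime p" and X: "padic_cauchy p X" and Y: "padic_cauchy p Y"
  shows "padic_cauchy p (\<lambda>n. X n * Y n)"
  unfolding padic_cauchy_def
proof (intro allI impI)
  fix e :: real assume e: "e > 0"
  obtain A where A: "A > 0" "\<And>n. rat_padic_abs p (X n) \<le> A" by (rule padic_cauchy_bounded[OF p X]) blast
  obtain B where B: "B > 0" "\<And>n. rat_padic_abs p (Y n) \<le> B" by (rule padic_cauchy_bounded[OF p Y]) blast
  obtain M where M: "\<And>m n. m \<ge> M \<Longrightarrow> n \<ge> M \<Longrightarrow> rat_padic_abs p (X m - X n) < e / B"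
    using X e B(1) unfolding padic_cauchy_def by (meson divide_pos_pos)
  obtain N where N: "\<And>m n. m \<ge> N \<Longrightarrow> n \<ge> N \<Longrightarrow> rat_padic_abs p (Y m - Y n) < e / A"
    using Y e A(1) unfolding padic_cauchy_def by (meson divide_pos_pos)
  show "\<exists>N. \<forall>m\<ge>N. \<forall>n\<ge>N. rat_padic_abs p (X m * Y m - X n * Y n) < e"
  proof (intro exI[of _ "max M N"] allI impI)
    fix m n assume mn: "m \<ge> max M N" "n \<ge> max M N"
    have 1: "rat_padic_abs p (X m * (Y m - Y n)) < e"
    proof -
      have "rat_padic_abs p (X m * (Y m - Y n)) \<le> A * rat_padic_abs p (Y m - Y n)"
        using A(2) by (simp add: rat_padic_abs_mult[OF p] mult_right_mono)
      also have "\<dots> < A * (e / A)" using N[of m n] mn A(1) by (intro mult_strict_left_mono) auto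
      finally show ?thesis using A(1) by simp
    qed
    have 2: "rat_padic_abs p (Y n * (X m - X n)) < e"
    proof -
      have "rat_padic_abs p (Y n * (X m - X n)) \<le> B * rat_padic_abs p (X m - X n)"
        using B(2) by (simp add: rat_padic_abs_mult[OF p] mult_right_mono)
      also have "\<dots> < B * (e / B)" using M[of m n] mn B(1) by (intro mult_strict_left_mono) auto
      finally show ?thesis using B(1) by simp
    qed
    have "X m * Y m - X n * Y n = X m * (Y m - Y n) + Y n * (X m - X n)" by (simp add: algebra_simps)
    thus "rat_padic_abs p (X m * Y m - X n * Y n) < e"
      using 1 2 rat_padic_abs_ultra[OF p, of "X m * (Y m - Y n)" "Y n * (X m - X n)"] by simp
  qed
qed

lemma padic_vanishes_mult_bounded:
  assumes p: "prime p" and X: "padic_cauchy p X" and Y: "padic_vanishes p Y"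
  shows "padic_vanishes p (\<lambda>n. X n * Y n)"
proof -
  obtain A where A: "A > 0" "\<And>n. rat_padic_abs p (X n) \<le> A" by (rule padic_cauchy_bounded[OF p X]) blast
  show ?thesis unfolding padic_vanishes_def
  proof (rule tendsto_sandwich[OF _ _ tendsto_const])
    show "(\<lambda>n. A * rat_padic_abs p (Y n)) \<longlonglongrightarrow> 0"
      using tendsto_mult_right_zero[OF Y[unfolded padic_vanishes_def]] by simp
  qed (auto simp: rat_padic_abs_mult[OF p] A mult_right_mono)
qed

lemma padic_cauchy_not_vanishes:
  assumes p: "prime p" and X: "padic_cauchy p X" and nv: "\<not> padic_vanishes p X"
  obtains b N where "b > 0" "\<And>n. n \<ge> N \<Longrightarrow> rat_padic_abs p (X n) > b"
proof -
  obtain L where L: "(\<lambda>n. rat_padic_abs p (X n)) \<longlonglongrightarrow> L"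
    using padic_cauchy_abs[OF p X] unfolding convergent_def by blast
  have "L \<ge> 0" using L by (rule LIMSEQ_le_const) auto
  moreover have "L \<noteq> 0" using L nv unfolding padic_vanishes_def by blast
  ultimately have "L > 0" by simp
  hence "eventually (\<lambda>n. rat_padic_abs p (X n) > L / 2) sequentially"
    using L by (intro order_tendstoD) auto
  thus ?thesis using that[of "L / 2"] \<open>L > 0\<close> unfolding eventually_sequentially by auto
qed

lemma padic_cauchy_inverse:
  assumes p: "prime p" and X: "padic_cauchy p X" and nv: "\<not> padic_vanishes p X"
  shows "padic_cauchy p (\<lambda>n. inverse (X n))"
  unfolding padic_cauchy_def
proof (intro allI impI)
  fix e :: real assume e: "e > 0"
  obtain b N where b: "b > 0" and N: "\<And>n. n \<ge> N \<Longrightarrow> rat_padic_abs p (X n) > b"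
    by (rule padic_cauchy_not_vanishes[OF p X nv]) blast
  obtain M where M: "\<And>m n. m \<ge> M \<Longrightarrow> n \<ge> M \<Longrightarrow> rat_padic_abs p (X m - X n) < e * (b * b)"
    using X e b unfolding padic_cauchy_def by (meson mult_pos_pos)
  show "\<exists>N. \<forall>m\<ge>N. \<forall>n\<ge>N. rat_padic_abs p (inverse (X m) - inverse (X n)) < e"
  proof (intro exI[of _ "max M N"] allI impI)
    fix m n assume mn: "m \<ge> max M N" "n \<ge> max M N"
    have gt: "rat_padic_abs p (X m) > b" "rat_padic_abs p (X n) > b" using N mn by auto
    hence nz: "X m \<noteq> 0" "X n \<noteq> 0" using b by auto
    have "rat_padic_abs p (X m - X n) < e * (b * b)" using M mn by auto
    also have "\<dots> \<le> e * (rat_padic_abs p (X m) * rat_padic_abs p (X n))"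
      using gt b e by (intro mult_left_mono mult_mono) auto
    finally have "rat_padic_abs p (X m - X n) < e * (rat_padic_abs p (X m) * rat_padic_abs p (X n))" .
    moreover have "rat_padic_abs p (inverse (X m) - inverse (X n)) =
        rat_padic_abs p (X m - X n) / (rat_padic_abs p (X m) * rat_padic_abs p (X n))"
      using nz by (simp add: inverse_diff_inverse[OF nz] rat_padic_abs_mult[OF p] rat_padic_abs_inverse[OF p])
        (simp add: divide_inverse)
    ultimately show "rat_padic_abs p (inverse (X m) - inverse (X n)) < e"
      using gt b by (simp add: divide_less_eq)
  qed
qed

lemma padic_rel_cauchy_refl [simp]: "padic_rel p X X \<longleftrightarrow> padic_cauchy p X"
  by (simp add: padic_rel_def padic_vanishes_def)

lemma part_equivp_padic_rel:
  assumes p: "prime p"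
  shows "part_equivp (padic_rel p)"
proof (rule part_equivpI)
  show "\<exists>X. padic_rel p X X" by (rule exI[of _ "\<lambda>_. 0"]) simp
  show "symp (padic_rel p)"
    by (simp add: symp_def padic_rel_def padic_vanishes_def rat_padic_abs_minus_commute)
  show "transp (padic_rel p)"
    unfolding padic_rel_def by (rule transpI) (force dest: padic_vanishes_add[OF p])
qed

text \<open>\<open>p\<close>-adic numbers are classes of \<open>p\<close>-adically Cauchy rational sequences modulo null sequences.\<close>

typedef (overloaded) 'p padic =
  "{C. \<exists>X. padic_cauchy CARD('p::prime_card) X \<and> C = {Y. padic_rel CARD('p) X Y}}"
  morphisms padic_class Abs_padic
  by (intro exI[of _ "{Y. padic_rel CARD('p) (\<lambda>_. 0) Y}"]) (auto intro!: exI[of _ "\<lambda>_. 0"])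

definition Padic :: "(nat \<Rightarrow> rat) \<Rightarrow> 'p::prime_card padic" where
  "Padic X = Abs_padic {Y. padic_rel CARD('p) X Y}"

definition rep_padic :: "'p::prime_card padic \<Rightarrow> nat \<Rightarrow> rat" where
  "rep_padic x = (SOME X. X \<in> padic_class x)"

definition cr_padic :: "(nat \<Rightarrow> rat) \<Rightarrow> 'p::prime_card padic \<Rightarrow> bool" where
  "cr_padic = (\<lambda>X y. padic_rel CARD('p) X X \<and> Padic X = y)"

lemma Quotient3_padic:
  "Quotient3 (padic_rel CARD('p::prime_card)) (Padic :: _ \<Rightarrow> 'p padic) rep_padic"
proof -
  interpret Q: quot_type "padic_rel CARD('p)" "Abs_padic :: _ \<Rightarrow> 'p padic" padic_class
  proof
    show "part_equivp (padic_rel CARD('p))" by (rule part_equivp_padic_rel[OF prime_card])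
    show "\<exists>X. padic_rel CARD('p) X X \<and> padic_class y = {Y. padic_rel CARD('p) X Y}" for y :: "'p padic"
      using padic_class[of y] by simp
    show "padic_class (Abs_padic C :: 'p padic) = C"
      if "\<exists>X. padic_rel CARD('p) X X \<and> C = {Y. padic_rel CARD('p) X Y}" for C
      using that by (intro Abs_padic_inverse) simp
  qed (simp_all only: padic_class_inverse padic_class_inject)
  have "Q.abs = Padic" "Q.rep = rep_padic"
    by (simp_all only: fun_eq_iff Q.abs_def Q.rep_def Padic_def rep_padic_def simp_thms)
  thus ?thesis using Q.Quotient by simp
qed

lemma Quotient_padic:
  "Quotient (padic_rel CARD('p::prime_card)) (Padic :: _ \<Rightarrow> 'p padic) rep_padic cr_padic"
  by (rule Quotient3_to_Quotient[OF Quotient3_padic cr_padic_def[THEN eq_reflection]])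

setup_lifting Quotient_padic

lemma cr_padic_eq: "pcr_padic = (\<lambda>X (y :: 'p::prime_card padic). padic_cauchy CARD('p) X \<and> Padic X = y)"
  unfolding padic.pcr_cr_eq cr_padic_def by (auto simp: padic_rel_def padic_vanishes_def)

lemma Domainp_pcr_padic [transfer_domain_rule]:
  "Domainp (pcr_padic :: _ \<Rightarrow> 'p::prime_card padic \<Rightarrow> _) = padic_cauchy CARD('p)"
  by (simp add: padic.domain_eq)

instantiation padic :: (prime_card) field
begin

lift_definition zero_padic :: "'a padic" is "\<lambda>_. 0" by simp

lift_definition one_padic :: "'a padic" is "\<lambda>_. 1" by simp

lift_definition plus_padic :: "'a padic \<Rightarrow> 'a padic \<Rightarrow> 'a padic" is "\<lambda>X Y n. X n + Y n"
  unfolding padic_rel_def add_diff_add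
  by (simp only: padic_cauchy_add[OF prime_card] padic_vanishes_add[OF prime_card] simp_thms)

lift_definition uminus_padic :: "'a padic \<Rightarrow> 'a padic" is "\<lambda>X n. - X n"
  unfolding padic_rel_def minus_diff_minus
  by (simp only: padic_cauchy_minus padic_vanishes_minus simp_thms)

lift_definition times_padic :: "'a padic \<Rightarrow> 'a padic \<Rightarrow> 'a padic" is "\<lambda>X Y n. X n * Y n"
proof -
  fix X X' Y Y' :: "nat \<Rightarrow> rat"
  assume *: "padic_rel CARD('a) X X'" "padic_rel CARD('a) Y Y'"
  have eq: "X n * Y n - X' n * Y' n = X n * (Y n - Y' n) + Y' n * (X n - X' n)" for n
    by (simp add: algebra_simps)
  show "padic_rel CARD('a) (\<lambda>n. X n * Y n) (\<lambda>n. X' n * Y' n)"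
    using * unfolding padic_rel_def eq
    by (intro conjI padic_cauchy_mult padic_vanishes_add padic_vanishes_mult_bounded prime_card) auto
qed

lift_definition inverse_padic :: "'a padic \<Rightarrow> 'a padic"
  is "\<lambda>X. if padic_vanishes CARD('a) X then (\<lambda>_. 0) else (\<lambda>n. inverse (X n))"
proof -
  fix X Y :: "nat \<Rightarrow> rat"
  let ?p = "CARD('a)"
  assume "padic_rel ?p X Y"
  hence X: "padic_cauchy ?p X" and Y: "padic_cauchy ?p Y" and XY: "padic_vanishes ?p (\<lambda>n. X n - Y n)"
    by (auto simp: padic_rel_def)
  have iff: "padic_vanishes ?p X \<longleftrightarrow> padic_vanishes ?p Y"
    using padic_vanishes_diff[OF prime_card _ XY, of X] padic_vanishes_add[OF prime_card _ XY, of Y] by auto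
  show "padic_rel ?p (if padic_vanishes ?p X then (\<lambda>_. 0) else (\<lambda>n. inverse (X n)))
                     (if padic_vanishes ?p Y then (\<lambda>_. 0) else (\<lambda>n. inverse (Y n)))"
  proof (cases "padic_vanishes ?p X")
    case False
    hence nX: "\<not> padic_vanishes ?p X" and nY: "\<not> padic_vanishes ?p Y" using iff by auto
    have iX: "padic_cauchy ?p (\<lambda>n. inverse (X n))" and iY: "padic_cauchy ?p (\<lambda>n. inverse (Y n))"
      using padic_cauchy_inverse[OF prime_card] X Y nX nY by auto
    obtain b N where b: "b > 0" "\<And>n. n \<ge> N \<Longrightarrow> rat_padic_abs ?p (X n) > b"
      by (rule padic_cauchy_not_vanishes[OF prime_card X nX]) blast
    obtain c M where c: "c > 0" "\<And>n. n \<ge> M \<Longrightarrow> rat_padic_abs ?p (Y n) > c"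
      by (rule padic_cauchy_not_vanishes[OF prime_card Y nY]) blast
    have "padic_vanishes ?p (\<lambda>n. inverse (X n) * inverse (Y n) * - (X n - Y n))"
      by (intro padic_vanishes_mult_bounded padic_cauchy_mult padic_vanishes_minus prime_card iX iY XY)
    moreover have "eventually (\<lambda>n. inverse (X n) * inverse (Y n) * - (X n - Y n) = inverse (X n) - inverse (Y n)) sequentially"
      using eventually_ge_at_top[of "max N M"]
    proof eventually_elim
      case (elim n)
      have "X n \<noteq> 0" "Y n \<noteq> 0" using b(1) b(2)[of n] c(1) c(2)[of n] elim by auto
      thus ?case by (simp add: field_simps)
    qed
    hence "eventually (\<lambda>n. rat_padic_abs ?p (inverse (X n) * inverse (Y n) * - (X n - Y n))
            = rat_padic_abs ?p (inverse (X n) - inverse (Y n))) sequentially"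
      by eventually_elim simp
    ultimately have "padic_vanishes ?p (\<lambda>n. inverse (X n) - inverse (Y n))"
      unfolding padic_vanishes_def by (rule Lim_transform_eventually)
    thus ?thesis using nX nY iX iY by (simp add: padic_rel_def)
  qed (use iff in auto)
qed

definition "x - y = x + - y" for x y :: "'a padic"

definition "x div y = x * inverse y" for x y :: "'a padic"

instance
proof
  fix a b c :: "'a padic"
  show "a + b = b + a"
    by transfer (simp add: ac_simps padic_cauchy_add[OF prime_card])
  show "(a + b) + c = a + (b + c)"
    by transfer (simp add: ac_simps padic_cauchy_add[OF prime_card])
  show "0 + a = a"
    by transfer simp
  show "- a + a = 0"
    by transfer simp
  show "a - b = a + - b"
    by (rule minus_padic_def)
  show "(a * b) * c = a * (b * c)"
    by transfer (simp add: ac_simps padic_cauchy_mult[OF prime_card])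
  show "a * b = b * a"
    by transfer (simp add: ac_simps padic_cauchy_mult[OF prime_card])
  show "1 * a = a"
    by transfer simp
  show "(a + b) * c = a * c + b * c"
    by transfer (simp add: distrib_right padic_cauchy_mult[OF prime_card] padic_cauchy_add[OF prime_card])
  show "(0 :: 'a padic) \<noteq> 1"
    by transfer (simp add: padic_rel_def padic_vanishes_def LIMSEQ_const_iff)
  have "padic_vanishes CARD('a) (\<lambda>n. inverse (X n) * X n - 1)"
    if X: "padic_cauchy CARD('a) X" "\<not> padic_vanishes CARD('a) X" for X
  proof -
    obtain d N where d: "d > 0" "\<And>n. n \<ge> N \<Longrightarrow> rat_padic_abs CARD('a) (X n) > d"
      by (rule padic_cauchy_not_vanishes[OF prime_card X]) blast
    have "eventually (\<lambda>n. rat_padic_abs CARD('a) (inverse (X n) * X n - 1) = 0) sequentially"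
      using eventually_ge_at_top[of N]
    proof eventually_elim
      case (elim n)
      hence "X n \<noteq> 0" using d(1) d(2)[of n] by auto
      thus ?case by simp
    qed
    thus ?thesis unfolding padic_vanishes_def by (rule tendsto_eventually)
  qed
  thus "a \<noteq> 0 \<Longrightarrow> inverse a * a = 1"
    by transfer (simp add: padic_rel_def padic_cauchy_mult[OF prime_card] padic_cauchy_inverse[OF prime_card])
  show "a div b = a * inverse b"
    by (rule divide_padic_def)
  show "inverse (0 :: 'a padic) = 0"
    by transfer (simp add: padic_vanishes_def)
qed

end

lemma Padic_cases:
  obtains X where "padic_cauchy CARD('p::prime_card) X" "(x :: 'p padic) = Padic X"
proof -
  have "padic_rel CARD('p) (rep_padic x) (rep_padic x)" "Padic (rep_padic x) = x"
    using Quotient_rep_reflp[OF Quotient_padic] Quotient_abs_rep[OF Quotient_padic] by auto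
  thus thesis using that[of "rep_padic x"] by simp
qed

lemma eq_Padic:
  assumes "padic_cauchy CARD('p::prime_card) X" "padic_cauchy CARD('p) Y"
  shows "(Padic X :: 'p padic) = Padic Y \<longleftrightarrow> padic_vanishes CARD('p) (\<lambda>n. X n - Y n)"
  using Quotient_rel[OF Quotient_padic[where 'p = 'p], of X Y] assms by (simp add: padic_rel_def)

lemma zero_Padic: "(0 :: 'p::prime_card padic) = Padic (\<lambda>_. 0)"
  using zero_padic.transfer[where 'a = 'p] by (simp add: cr_padic_eq)

lemma one_Padic: "(1 :: 'p::prime_card padic) = Padic (\<lambda>_. 1)"
  using one_padic.transfer[where 'a = 'p] by (simp add: cr_padic_eq)

lemma add_Padic:
  assumes "padic_cauchy CARD('p::prime_card) X" "padic_cauchy CARD('p) Y"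
  shows "(Padic X :: 'p padic) + Padic Y = Padic (\<lambda>n. X n + Y n)"
  using plus_padic.transfer[where 'a = 'p] assms by (simp add: cr_padic_eq rel_fun_def)

lemma minus_Padic:
  assumes "padic_cauchy CARD('p::prime_card) X"
  shows "- (Padic X :: 'p padic) = Padic (\<lambda>n. - X n)"
  using uminus_padic.transfer[where 'a = 'p] assms by (simp add: cr_padic_eq rel_fun_def)

lemma diff_Padic:
  assumes "padic_cauchy CARD('p::prime_card) X" "padic_cauchy CARD('p) Y"
  shows "(Padic X :: 'p padic) - Padic Y = Padic (\<lambda>n. X n - Y n)"
  using assms by (simp add: minus_padic_def minus_Padic add_Padic padic_cauchy_minus)

lemma mult_Padic:
  assumes "padic_cauchy CARD('p::prime_card) X" "padic_cauchy CARD('p) Y"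
  shows "(Padic X :: 'p padic) * Padic Y = Padic (\<lambda>n. X n * Y n)"
  using times_padic.transfer[where 'a = 'p] assms by (simp add: cr_padic_eq rel_fun_def)

lift_definition padic_norm :: "'a::prime_card padic \<Rightarrow> real" is "\<lambda>X. lim (\<lambda>n. rat_padic_abs CARD('a) (X n))"
proof -
  fix X Y :: "nat \<Rightarrow> rat"
  let ?v = "rat_padic_abs CARD('a)"
  assume "padic_rel CARD('a) X Y"
  hence X: "padic_cauchy CARD('a) X" and XY: "(\<lambda>n. ?v (X n - Y n)) \<longlonglongrightarrow> 0"
    by (auto simp: padic_rel_def padic_vanishes_def)
  have LX: "(\<lambda>n. ?v (X n)) \<longlonglongrightarrow> lim (\<lambda>n. ?v (X n))"
    using padic_cauchy_abs[OF prime_card X] by (simp add: convergent_LIMSEQ_iff)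
  have "(\<lambda>n. ?v (X n) - ?v (Y n)) \<longlonglongrightarrow> 0"
    by (rule Lim_null_comparison[OF _ XY]) (simp add: rat_padic_abs_reverse_triangle[OF prime_card])
  hence "(\<lambda>n. ?v (Y n)) \<longlonglongrightarrow> lim (\<lambda>n. ?v (X n))"
    using tendsto_diff[OF LX, of "\<lambda>n. ?v (X n) - ?v (Y n)" 0] by simp
  thus "lim (\<lambda>n. ?v (X n)) = lim (\<lambda>n. ?v (Y n))" by (simp add: limI)
qed

lemma norm_Padic:
  assumes "padic_cauchy CARD('p::prime_card) X"
  shows "(\<lambda>n. rat_padic_abs CARD('p) (X n)) \<longlonglongrightarrow> padic_norm (Padic X :: 'p padic)"
proof -
  have "padic_norm (Padic X :: 'p padic) = lim (\<lambda>n. rat_padic_abs CARD('p) (X n))"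
    using padic_norm.transfer[where 'a = 'p] assms by (simp add: cr_padic_eq rel_fun_def)
  thus ?thesis using padic_cauchy_abs[OF prime_card assms] by (simp add: convergent_LIMSEQ_iff)
qed

lemma norm_Padic_const [simp]: "padic_norm (Padic (\<lambda>_. r) :: 'p::prime_card padic) = rat_padic_abs CARD('p) r"
  using norm_Padic[of "\<lambda>_. r", where 'p = 'p] by (simp add: LIMSEQ_const_iff)

lemma padic_norm_nonneg [simp]: "padic_norm (x :: 'p::prime_card padic) \<ge> 0"
proof -
  obtain X where X: "padic_cauchy CARD('p) X" "x = Padic X" by (rule Padic_cases)
  show ?thesis unfolding X(2) by (rule LIMSEQ_le_const[OF norm_Padic[OF X(1)]]) auto
qed

lemma padic_norm_eq_0_iff [simp]: "padic_norm (x :: 'p::prime_card padic) = 0 \<longleftrightarrow> x = 0"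
proof -
  obtain X where X: "padic_cauchy CARD('p) X" "x = Padic X" by (rule Padic_cases)
  show ?thesis
    using norm_Padic[OF X(1)] X eq_Padic[OF X(1) padic_cauchy_const[of _ 0]]
    by (auto simp: zero_Padic padic_vanishes_def)
qed

lemma padic_norm_zero [simp]: "padic_norm (0 :: 'p::prime_card padic) = 0"
  by simp

lemma padic_norm_minus [simp]: "padic_norm (- x :: 'p::prime_card padic) = padic_norm x"
proof -
  obtain X where X: "padic_cauchy CARD('p) X" "x = Padic X" by (rule Padic_cases)
  show ?thesis
    using norm_Padic[OF X(1)] norm_Padic[OF padic_cauchy_minus[OF X(1)]] X
    by (auto simp: minus_Padic intro: LIMSEQ_unique)
qed

lemma padic_of_nat: "(of_nat n :: 'p::prime_card padic) = Padic (\<lambda>_. of_nat n)"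
  by (induction n) (simp_all add: zero_Padic one_Padic add_Padic)

lemma padic_norm_prime: "padic_norm (of_nat CARD('p) :: 'p::prime_card padic) = 1 / real CARD('p)"
  by (simp add: padic_of_nat rat_padic_abs_p[OF prime_card])

lemma padic_norm_minus_commute: "padic_norm (x - y :: 'p::prime_card padic) = padic_norm (y - x)"
  by (metis minus_diff_eq padic_norm_minus)

lemma padic_norm_mult: "padic_norm (x * y :: 'p::prime_card padic) = padic_norm x * padic_norm y"
proof -
  obtain X where X: "padic_cauchy CARD('p) X" "x = Padic X" by (rule Padic_cases)
  obtain Y where Y: "padic_cauchy CARD('p) Y" "y = Padic Y" by (rule Padic_cases)
  show ?thesis
    using tendsto_mult[OF norm_Padic[OF X(1)] norm_Padic[OF Y(1)]]
      norm_Padic[OF padic_cauchy_mult[OF prime_card X(1) Y(1)]] X Y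
    by (auto simp: mult_Padic rat_padic_abs_mult[OF prime_card] intro: LIMSEQ_unique)
qed

lemma padic_norm_ultra: "padic_norm (x + y :: 'p::prime_card padic) \<le> max (padic_norm x) (padic_norm y)"
proof -
  obtain X where X: "padic_cauchy CARD('p) X" "x = Padic X" by (rule Padic_cases)
  obtain Y where Y: "padic_cauchy CARD('p) Y" "y = Padic Y" by (rule Padic_cases)
  show ?thesis unfolding X(2) Y(2) add_Padic[OF X(1) Y(1)]
    by (rule LIMSEQ_le[OF norm_Padic[OF padic_cauchy_add[OF prime_card X(1) Y(1)]]
            tendsto_max[OF norm_Padic[OF X(1)] norm_Padic[OF Y(1)]]])
       (simp add: rat_padic_abs_ultra[OF prime_card])
qed

lemma padic_norm_ultra_diff: "padic_norm (x - z :: 'p::prime_card padic) \<le> max (padic_norm (x - y)) (padic_norm (y - z))"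
  using padic_norm_ultra[of "x - y" "y - z"] by simp

instantiation padic :: (prime_card) metric_space
begin

definition "dist x y = padic_norm (x - y)" for x y :: "'a padic"

definition uniformity_padic :: "('a padic \<times> 'a padic) filter" where
  "uniformity_padic = (INF e\<in>{0<..}. principal {(x, y). dist x y < e})"

definition open_padic :: "'a padic set \<Rightarrow> bool" where
  "open_padic U \<longleftrightarrow> (\<forall>x\<in>U. eventually (\<lambda>(x', y). x' = x \<longrightarrow> y \<in> U) uniformity)"

instance
proof
  fix x y z :: "'a padic"
  show "dist x y = 0 \<longleftrightarrow> x = y" by (simp add: dist_padic_def)
  have "dist x y \<le> max (padic_norm (x - z)) (padic_norm (z - y))"
    unfolding dist_padic_def by (rule padic_norm_ultra_diff)
  also have "\<dots> \<le> padic_norm (x - z) + padic_norm (y - z)"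
    by (simp add: padic_norm_minus_commute[of y z])
  finally show "dist x y \<le> dist x z + dist y z" by (simp add: dist_padic_def)
qed (rule uniformity_padic_def open_padic_def)+

end

subsection \<open>Haar measure\<close>

text \<open>
  Regularity and finiteness on compact sets are not demanded, since they follow: the unit ball is
  open and has measure 1, so the measure is locally finite on a \<open>\<sigma>\<close>-compact metric space.
  Existence is shown below.
\<close>

definition normalized_haar_measure :: "'p::prime_card padic measure \<Rightarrow> bool" where
  "normalized_haar_measure M \<longleftrightarrow>
     sets M = sets borel \<and>
     (\<forall>a. \<forall>A\<in>sets borel. emeasure M ((\<lambda>x. a + x) ` A) = emeasure M A) \<and>
     emeasure M {x. padic_norm x \<le> 1} = 1"

text \<open>
  For existence, Lebesgue measure on \<open>[0, \<infinity>)\<close> is transported along the map that reflects base-\<open>p\<close>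
  digits at the point: \<open>\<Sum>a\<^sub>i p\<^sup>i\<close> goes to \<open>\<Sum>a\<^sub>i p\<^bsup>-i-1\<^esup>\<close>. It takes intervals
  \<open>[m/p\<^sup>n, (m+1)/p\<^sup>n)\<close> to balls of radius \<open>p\<^bsup>-n\<^esup>\<close>.
\<close>

fun radical_inverse :: "nat \<Rightarrow> nat \<Rightarrow> rat" where
  "radical_inverse p m = (if m = 0 \<or> p \<le> 1 then 0
     else (of_nat (m mod p) + radical_inverse p (m div p)) / of_nat p)"

declare radical_inverse.simps [simp del]

lemma radical_inverse_0 [simp]: "radical_inverse p 0 = 0"
  by (simp add: radical_inverse.simps)

lemma radical_inverse_unfold:
  "prime p \<Longrightarrow> of_nat p * radical_inverse p m = of_nat (m mod p) + radical_inverse p (m div p)"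
  using prime_gt_1_nat[of p]
  by (cases "m = 0") (simp_all add: radical_inverse.simps[of p m])

lemma rat_padic_abs_digit:
  assumes p: "prime p" and le: "rat_padic_abs p u \<le> 1"
  obtains d where "d < p" "rat_padic_abs p (u - of_nat d) \<le> 1 / real p"
proof -
  obtain a b where u: "u = of_int a / of_int b" and b: "b > 0" and nb: "\<not> int p dvd b"
    and vb: "rat_padic_abs p (of_int b) = 1" by (rule rat_padic_abs_le_1E[OF p le])
  have "coprime (int p) b" using nb p by (simp add: prime_imp_coprime)
  then obtain c e where ce: "c * b + e * int p = 1"
    using bezout_int[of b "int p"] by (auto simp: coprime_iff_gcd_eq_1 gcd.commute)
  define d where "d = (a * c) mod int p"
  have p0: "int p > 0" using p prime_gt_0_nat by auto
  have d: "0 \<le> d" "d < int p" using p0 by (auto simp: d_def)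
  have "a - d * b = a * (c * b + e * int p) - d * b" using ce by simp
  also have "\<dots> = (a * c - d) * b + a * e * int p" by (simp add: algebra_simps)
  finally have "int p ^ 1 dvd a - d * b"
    by (simp add: d_def minus_mod_eq_mult_div mult.assoc)
  hence "rat_padic_abs p (of_int (a - d * b)) \<le> 1 / real p ^ 1"
    using rat_padic_abs_int_le_iff[OF p] by blast
  moreover have "u - of_nat (nat d) = of_int (a - d * b) * inverse (of_int b)"
    using d b by (simp add: u field_simps)
  ultimately have "rat_padic_abs p (u - of_nat (nat d)) \<le> 1 / real p"
    by (simp add: rat_padic_abs_mult[OF p] rat_padic_abs_inverse[OF p] vb)
  thus thesis using that[of "nat d"] d by auto
qed

lemma radical_inverse_approx:
  assumes p: "prime p"
  shows "rat_padic_abs p r \<le> real p ^ j \<Longrightarrow> \<exists>m. rat_padic_abs p (r - radical_inverse p m) \<le> 1"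
proof (induction j arbitrary: r)
  case 0
  thus ?case by (intro exI[of _ 0]) simp
next
  case (Suc j)
  have p0: "real p > 0" "of_nat p \<noteq> (0::rat)" using p prime_gt_0_nat by auto
  have "rat_padic_abs p (of_nat p * r) \<le> real p ^ j"
    using Suc.prems p0 by (simp add: rat_padic_abs_mult[OF p] rat_padic_abs_p[OF p] field_simps)
  then obtain m where "rat_padic_abs p (of_nat p * r - radical_inverse p m) \<le> 1"
    using Suc.IH by blast
  then obtain d where d: "d < p" "rat_padic_abs p (of_nat p * r - radical_inverse p m - of_nat d) \<le> 1 / real p"
    by (rule rat_padic_abs_digit[OF p])
  have "of_nat p * radical_inverse p (d + p * m) = of_nat d + radical_inverse p m"
    using d(1) by (simp add: radical_inverse_unfold[OF p])
  hence "of_nat p * r - radical_inverse p m - of_nat d = of_nat p * (r - radical_inverse p (d + p * m))"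
    by (simp add: algebra_simps)
  hence "1 / real p * rat_padic_abs p (r - radical_inverse p (d + p * m)) \<le> 1 / real p * 1"
    using d(2) by (simp add: rat_padic_abs_mult[OF p] rat_padic_abs_p[OF p])
  hence "rat_padic_abs p (r - radical_inverse p (d + p * m)) \<le> 1"
    using p0 by (subst (asm) mult_le_cancel_left_pos) auto
  thus ?case by blast
qed

lemma radical_inverse_unique:
  assumes p: "prime p"
  shows "rat_padic_abs p (radical_inverse p m - radical_inverse p m') \<le> 1 \<Longrightarrow> m = m'"
proof (induction "m + m'" arbitrary: m m' rule: less_induct)
  case less
  have p1: "p > 1" using p prime_gt_1_nat by auto
  show ?case
  proof (cases "m = 0 \<and> m' = 0")
    case False
    let ?R = "radical_inverse p"
    let ?v = "rat_padic_abs p"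
    let ?d = "int (m mod p) - int (m' mod p)"
    let ?w = "of_nat p * (?R m - ?R m')"
    have eq: "?w = of_int ?d + (?R (m div p) - ?R (m' div p))"
      using radical_inverse_unfold[OF p, of m] radical_inverse_unfold[OF p, of m']
      by (simp add: algebra_simps)
    have "?v ?w = 1 / real p * ?v (?R m - ?R m')"
      by (simp only: rat_padic_abs_mult[OF p] rat_padic_abs_p[OF p])
    also have "\<dots> \<le> 1 / real p * 1" using less.prems p1 by (intro mult_left_mono) auto
    finally have w: "?v ?w \<le> 1 / real p" by simp
    have "?R (m div p) - ?R (m' div p) = ?w - of_int ?d" using eq by simp
    hence "?v (?R (m div p) - ?R (m' div p)) \<le> max (?v ?w) (?v (of_int ?d))"
      using rat_padic_abs_ultra_diff[OF p] by presburger
    also have "\<dots> \<le> 1"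
    proof -
      have "1 / real p \<le> 1" using p1 by simp
      thus ?thesis using w rat_padic_abs_int_le_1[OF p, of ?d] by linarith
    qed
    finally have le: "?v (?R (m div p) - ?R (m' div p)) \<le> 1" .
    have "m div p + m' div p < m + m'"
    proof (cases "m = 0")
      case True
      thus ?thesis using False p1 by simp
    next
      case False
      hence "m div p < m" using p1 by simp
      moreover have "m' div p \<le> m'" by simp
      ultimately show ?thesis by linarith
    qed
    hence q: "m div p = m' div p" using less.hyps le by blast
    hence "?v (of_int ?d) \<le> 1 / real p ^ 1" using w eq by simp
    hence "int p ^ 1 dvd ?d" using rat_padic_abs_int_le_iff[OF p] by blast
    moreover have "\<bar>?d\<bar> < int p"
    proof -
      have "m mod p < p" "m' mod p < p" using p1 by auto
      thus ?thesis by linarith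
    qed
    ultimately have "?d = 0" using dvd_imp_le_int[of ?d "int p"] by (cases "?d = 0") auto
    hence "m mod p = m' mod p" by linarith
    thus ?thesis using q by (metis div_mult_mod_eq)
  qed auto
qed

definition padic_point :: "nat \<Rightarrow> nat \<Rightarrow> 'p::prime_card padic" where
  "padic_point n m = Padic (\<lambda>_. of_nat CARD('p) ^ n * radical_inverse CARD('p) m)"

definition padic_cell :: "nat \<Rightarrow> 'p::prime_card padic \<Rightarrow> 'p padic set" where
  "padic_cell n x = {y. padic_norm (y - x) \<le> 1 / real CARD('p) ^ n}"

lemma padic_cell_eq:
  assumes "y \<in> padic_cell n (x :: 'p::prime_card padic)"
  shows "padic_cell n y = padic_cell n x"
proof -
  have "padic_norm (z - x) \<le> 1 / real CARD('p) ^ n \<longleftrightarrow> padic_norm (z - y) \<le> 1 / real CARD('p) ^ n" for z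
    using assms padic_norm_ultra_diff[of z x y] padic_norm_ultra_diff[of z y x] padic_norm_minus_commute[of x y]
    unfolding padic_cell_def by auto
  thus ?thesis unfolding padic_cell_def by blast
qed

lemma CARD_prime_gt_1: "real CARD('p::prime_card) > 1"
  using prime_gt_1_nat[OF prime_card[where 'a = 'p]] by simp

lemma padic_cell_antimono:
  assumes "k \<le> n"
  shows "padic_cell n (x :: 'p::prime_card padic) \<subseteq> padic_cell k x"
proof -
  have "1 / real CARD('p) ^ n \<le> 1 / real CARD('p) ^ k"
    using assms CARD_prime_gt_1[where 'p = 'p] by (intro divide_left_mono power_increasing) auto
  thus ?thesis unfolding padic_cell_def by auto
qed

lemma padic_cell_self [simp]: "x \<in> padic_cell n (x :: 'p::prime_card padic)"
  by (simp add: padic_cell_def)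

lemma padic_approx_rat:
  assumes "e > 0"
  obtains r where "padic_norm ((x :: 'p::prime_card padic) - Padic (\<lambda>_. r)) \<le> e"
proof -
  obtain X where X: "padic_cauchy CARD('p) X" "x = Padic X" by (rule Padic_cases)
  obtain N where N: "\<And>m n. m \<ge> N \<Longrightarrow> n \<ge> N \<Longrightarrow> rat_padic_abs CARD('p) (X m - X n) < e"
    using X(1) assms unfolding padic_cauchy_def by meson
  have "padic_cauchy CARD('p) (\<lambda>n. X n - X N)"
    using padic_cauchy_add[OF prime_card X(1) padic_cauchy_const[of _ "- X N"]] by simp
  hence "(\<lambda>n. rat_padic_abs CARD('p) (X n - X N)) \<longlonglongrightarrow> padic_norm (x - Padic (\<lambda>_. X N))"
    unfolding X(2) diff_Padic[OF X(1) padic_cauchy_const] by (rule norm_Padic)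
  hence "padic_norm (x - Padic (\<lambda>_. X N)) \<le> e"
    by (rule LIMSEQ_le_const2) (use N in \<open>auto intro!: exI[of _ N] less_imp_le\<close>)
  thus thesis using that by blast
qed

lemma padic_point_ex: "\<exists>m. (x :: 'p::prime_card padic) \<in> padic_cell n (padic_point n m)"
proof -
  let ?p = "CARD('p)"
  have p: "prime ?p" by (rule prime_card)
  have p1: "real ?p > 1" by (rule CARD_prime_gt_1)
  obtain r where r: "padic_norm (x - Padic (\<lambda>_. r)) \<le> 1 / real ?p ^ n"
    using padic_approx_rat[of "1 / real ?p ^ n" x] p1 by auto
  let ?s = "r / of_nat ?p ^ n"
  obtain j where "rat_padic_abs ?p ?s < real ?p ^ j" using real_arch_pow[OF p1] by blast
  then obtain m where m: "rat_padic_abs ?p (?s - radical_inverse ?p m) \<le> 1"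
    using radical_inverse_approx[OF p, of ?s j] by auto
  have "r - of_nat ?p ^ n * radical_inverse ?p m = of_nat ?p ^ n * (?s - radical_inverse ?p m)"
    using p1 by (simp add: right_diff_distrib)
  hence "rat_padic_abs ?p (r - of_nat ?p ^ n * radical_inverse ?p m) =
      1 / real ?p ^ n * rat_padic_abs ?p (?s - radical_inverse ?p m)"
    by (simp add: rat_padic_abs_mult[OF p] rat_padic_abs_power[OF p] rat_padic_abs_p[OF p] power_one_over)
  also have "\<dots> \<le> 1 / real ?p ^ n * 1" using m p1 by (intro mult_left_mono) auto
  finally have "padic_norm (Padic (\<lambda>_. r) - padic_point n m :: 'p padic) \<le> 1 / real ?p ^ n"
    by (simp add: padic_point_def diff_Padic)
  hence "x \<in> padic_cell n (padic_point n m)"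
    using r padic_norm_ultra_diff[of x "padic_point n m" "Padic (\<lambda>_. r)"] by (auto simp: padic_cell_def)
  thus ?thesis by blast
qed

lemma padic_point_unique:
  assumes "(padic_point n m :: 'p::prime_card padic) \<in> padic_cell n (padic_point n m')"
  shows "m = m'"
proof -
  let ?p = "CARD('p)"
  have p: "prime ?p" by (rule prime_card)
  have p1: "real ?p > 1" by (rule CARD_prime_gt_1)
  have "rat_padic_abs ?p (of_nat ?p ^ n * (radical_inverse ?p m - radical_inverse ?p m')) \<le> 1 / real ?p ^ n"
    using assms by (simp add: padic_cell_def padic_point_def diff_Padic right_diff_distrib)
  hence "1 / real ?p ^ n * rat_padic_abs ?p (radical_inverse ?p m - radical_inverse ?p m') \<le> 1 / real ?p ^ n * 1"
    by (simp add: rat_padic_abs_mult[OF p] rat_padic_abs_power[OF p] rat_padic_abs_p[OF p] power_one_over)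
  hence "rat_padic_abs ?p (radical_inverse ?p m - radical_inverse ?p m') \<le> 1"
    using p1 by (subst (asm) mult_le_cancel_left_pos) auto
  thus ?thesis by (rule radical_inverse_unique[OF p])
qed

definition monna_seq :: "nat \<Rightarrow> real \<Rightarrow> nat \<Rightarrow> rat" where
  "monna_seq p t n = of_nat p ^ n * radical_inverse p (nat \<lfloor>t * real p ^ n\<rfloor>)"

lemma monna_seq_step:
  assumes p: "prime p" and t: "t \<ge> 0"
  shows "rat_padic_abs p (monna_seq p t (n + k) - monna_seq p t n) \<le> 1 / real p ^ n"
proof (induction k)
  case (Suc k)
  have p1: "real p > 1" "p > 0" using prime_gt_1_nat[OF p] by auto
  let ?m = "nat \<lfloor>t * real p ^ Suc (n + k)\<rfloor>"
  have "\<lfloor>t * real p ^ (n + k)\<rfloor> = \<lfloor>(t * real p ^ Suc (n + k)) / real_of_int (int p)\<rfloor>"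
    using p1 by simp
  also have "\<dots> = \<lfloor>t * real p ^ Suc (n + k)\<rfloor> div int p"
    by (rule floor_divide_real_eq_div) simp
  finally have "nat \<lfloor>t * real p ^ (n + k)\<rfloor> = ?m div p"
    using t by (simp add: nat_div_distrib del: power_Suc)
  moreover have "monna_seq p t (Suc (n + k)) = of_nat p ^ (n + k) * (of_nat p * radical_inverse p ?m)"
    by (simp add: monna_seq_def)
  ultimately have "monna_seq p t (Suc (n + k)) - monna_seq p t (n + k) = of_nat p ^ (n + k) * of_int (int (?m mod p))"
    unfolding radical_inverse_unfold[OF p] by (simp add: monna_seq_def algebra_simps)
  hence "rat_padic_abs p (monna_seq p t (Suc (n + k)) - monna_seq p t (n + k)) =
      1 / real p ^ (n + k) * rat_padic_abs p (of_int (int (?m mod p)))"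
    by (simp only: rat_padic_abs_mult[OF p] rat_padic_abs_power[OF p] rat_padic_abs_p[OF p] power_one_over)
  also have "\<dots> \<le> 1 / real p ^ (n + k) * 1"
    using p1 by (intro mult_left_mono rat_padic_abs_int_le_1[OF p]) auto
  also have "\<dots> \<le> 1 / real p ^ n"
  proof -
    have "real p ^ n \<le> real p ^ (n + k)" using p1 by (intro power_increasing) auto
    thus ?thesis using p1 by (simp add: frac_le)
  qed
  finally have "rat_padic_abs p (monna_seq p t (Suc (n + k)) - monna_seq p t (n + k)) \<le> 1 / real p ^ n" .
  thus ?case
    using Suc rat_padic_abs_ultra[OF p, of "monna_seq p t (Suc (n + k)) - monna_seq p t (n + k)" "monna_seq p t (n + k) - monna_seq p t n"]
    by simp
qed simp

lemma monna_seq_cauchy: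
  assumes p: "prime p" and t: "t \<ge> 0"
  shows "padic_cauchy p (monna_seq p t)"
  unfolding padic_cauchy_def
proof (intro allI impI)
  fix e :: real assume e: "e > 0"
  have p1: "real p > 1" using prime_gt_1_nat[OF p] by auto
  obtain N where "(1 / real p) ^ N < e" using real_arch_pow_inv[of e "1 / real p"] e p1 by auto
  hence N: "1 / real p ^ N < e" by (simp add: power_one_over)
  show "\<exists>N. \<forall>m\<ge>N. \<forall>n\<ge>N. rat_padic_abs p (monna_seq p t m - monna_seq p t n) < e"
  proof (intro exI[of _ N] allI impI)
    fix m n assume "m \<ge> N" "n \<ge> N"
    hence "rat_padic_abs p (monna_seq p t m - monna_seq p t N) \<le> 1 / real p ^ N"
      "rat_padic_abs p (monna_seq p t n - monna_seq p t N) \<le> 1 / real p ^ N"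
      using monna_seq_step[OF p t, of N "m - N"] monna_seq_step[OF p t, of N "n - N"] by auto
    thus "rat_padic_abs p (monna_seq p t m - monna_seq p t n) < e"
      using N rat_padic_abs_ultra_diff[OF p, of "monna_seq p t m - monna_seq p t N" "monna_seq p t n - monna_seq p t N"]
      by simp
  qed
qed

definition monna :: "real \<Rightarrow> 'p::prime_card padic" where
  "monna t = Padic (monna_seq CARD('p) t)"

lemma monna_cell:
  assumes t: "t \<ge> 0"
  shows "(monna t :: 'p::prime_card padic) \<in> padic_cell n (padic_point n (nat \<lfloor>t * real CARD('p) ^ n\<rfloor>))"
proof -
  let ?X = "monna_seq CARD('p) t"
  have X: "padic_cauchy CARD('p) ?X" by (rule monna_seq_cauchy[OF prime_card t])
  have pt: "padic_point n (nat \<lfloor>t * real CARD('p) ^ n\<rfloor>) = (Padic (\<lambda>_. ?X n) :: 'p padic)"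
    by (simp add: padic_point_def monna_seq_def)
  have "padic_cauchy CARD('p) (\<lambda>k. ?X k - ?X n)"
    using padic_cauchy_add[OF prime_card X padic_cauchy_const[of _ "- ?X n"]] by simp
  hence "(\<lambda>k. rat_padic_abs CARD('p) (?X k - ?X n)) \<longlonglongrightarrow> padic_norm (monna t - Padic (\<lambda>_. ?X n) :: 'p padic)"
    unfolding monna_def diff_Padic[OF X padic_cauchy_const] by (rule norm_Padic)
  hence "padic_norm (monna t - Padic (\<lambda>_. ?X n) :: 'p padic) \<le> 1 / real CARD('p) ^ n"
  proof (rule LIMSEQ_le_const2)
    show "\<exists>N. \<forall>k\<ge>N. rat_padic_abs CARD('p) (?X k - ?X n) \<le> 1 / real CARD('p) ^ n"
    proof (intro exI[of _ n] allI impI)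
      fix k assume "k \<ge> n"
      thus "rat_padic_abs CARD('p) (?X k - ?X n) \<le> 1 / real CARD('p) ^ n"
        using monna_seq_step[OF prime_card[where 'a = 'p] t, of n "k - n"] by simp
    qed
  qed
  thus ?thesis by (simp add: padic_cell_def pt)
qed

lemma monna_vimage:
  "{t. t \<ge> 0 \<and> (monna t :: 'p::prime_card padic) \<in> padic_cell n (padic_point n m)} =
   {real m / real CARD('p) ^ n ..< (real m + 1) / real CARD('p) ^ n}"
proof -
  let ?p = "real CARD('p)"
  have p1: "?p ^ n > 0" using CARD_prime_gt_1[where 'p = 'p] by simp
  have *: "(monna t :: 'p padic) \<in> padic_cell n (padic_point n m) \<longleftrightarrow> nat \<lfloor>t * ?p ^ n\<rfloor> = m"
    if t: "t \<ge> 0" for t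
  proof
    assume "(monna t :: 'p padic) \<in> padic_cell n (padic_point n m)"
    hence "padic_cell n (padic_point n (nat \<lfloor>t * ?p ^ n\<rfloor>) :: 'p padic) = padic_cell n (padic_point n m)"
      using padic_cell_eq monna_cell[OF t, where 'p = 'p] by blast
    thus "nat \<lfloor>t * ?p ^ n\<rfloor> = m" using padic_point_unique padic_cell_self by blast
  qed (use monna_cell[OF t, where 'p = 'p] in auto)
  have **: "t \<ge> 0 \<and> nat \<lfloor>t * ?p ^ n\<rfloor> = m \<longleftrightarrow> real m \<le> t * ?p ^ n \<and> t * ?p ^ n < real m + 1" for t
  proof
    assume "t \<ge> 0 \<and> nat \<lfloor>t * ?p ^ n\<rfloor> = m"
    moreover from this have "t * ?p ^ n \<ge> 0" using p1 by simp
    ultimately show "real m \<le> t * ?p ^ n \<and> t * ?p ^ n < real m + 1" by linarith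
  next
    assume a: "real m \<le> t * ?p ^ n \<and> t * ?p ^ n < real m + 1"
    hence "t * ?p ^ n \<ge> 0" by linarith
    hence "t \<ge> 0" using p1 by (simp add: zero_le_mult_iff)
    moreover have "nat \<lfloor>t * ?p ^ n\<rfloor> = m" using a by linarith
    ultimately show "t \<ge> 0 \<and> nat \<lfloor>t * ?p ^ n\<rfloor> = m" by blast
  qed
  have "t \<ge> 0 \<and> (monna t :: 'p padic) \<in> padic_cell n (padic_point n m) \<longleftrightarrow>
      real m / ?p ^ n \<le> t \<and> t < (real m + 1) / ?p ^ n" for t
    using *[of t] **[of t] p1 by (auto simp: divide_le_eq less_divide_eq)
  thus ?thesis by (intro set_eqI) (simp only: mem_Collect_eq atLeastLessThan_iff)
qed

definition padic_cells :: "'p::prime_card padic set set" where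
  "padic_cells = insert {} {padic_cell n x | n x. True}"

lemma padic_cell_open: "open (padic_cell n (x :: 'p::prime_card padic))"
  unfolding open_dist
proof (intro ballI exI conjI allI impI)
  show "1 / real CARD('p) ^ n > 0" using CARD_prime_gt_1[where 'p = 'p] by simp
  fix y z assume "y \<in> padic_cell n x" "dist z y < 1 / real CARD('p) ^ n"
  moreover from this have "z \<in> padic_cell n y" by (simp add: padic_cell_def dist_padic_def)
  ultimately show "z \<in> padic_cell n x" using padic_cell_eq[of y n x] by blast
qed

lemma padic_cell_basis:
  assumes "open U" "x \<in> (U :: 'p::prime_card padic set)"
  shows "\<exists>n. padic_cell n x \<subseteq> U"
proof -
  obtain e where e: "e > 0" "\<And>y. dist y x < e \<Longrightarrow> y \<in> U" using assms unfolding open_dist by blast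
  obtain n where "(1 / real CARD('p)) ^ n < e"
    using real_arch_pow_inv[of e "1 / real CARD('p)"] e CARD_prime_gt_1[where 'p = 'p] by auto
  hence "padic_cell n x \<subseteq> U" using e(2) by (auto simp: padic_cell_def dist_padic_def power_one_over)
  thus ?thesis by blast
qed

lemma countable_padic_cells: "countable (padic_cells :: 'p::prime_card padic set set)"
proof -
  have "padic_cells \<subseteq> insert {} ((\<lambda>(n, m). padic_cell n (padic_point n m :: 'p padic)) ` UNIV)"
  proof
    fix C :: "'p padic set" assume "C \<in> padic_cells"
    then consider "C = {}" | n x where "C = padic_cell n x" by (auto simp: padic_cells_def)
    thus "C \<in> insert {} ((\<lambda>(n, m). padic_cell n (padic_point n m :: 'p padic)) ` UNIV)"
    proof cases
      case 2
      obtain m where "x \<in> padic_cell n (padic_point n m)" using padic_point_ex by blast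
      hence "C = padic_cell n (padic_point n m)" using 2 padic_cell_eq by blast
      thus ?thesis by (auto intro!: image_eqI[of _ _ "(n, m)"])
    qed simp
  qed
  thus ?thesis by (rule countable_subset) auto
qed

lemma borel_padic: "(borel :: 'p::prime_card padic measure) = sigma UNIV padic_cells"
  unfolding borel_def
proof (rule sigma_eqI)
  show "sigma_sets UNIV {S :: 'p padic set. open S} = sigma_sets UNIV padic_cells"
  proof (rule sigma_sets_eqI)
    fix U :: "'p padic set" assume "U \<in> {S. open S}"
    hence "open U" by simp
    have "U = \<Union>{C \<in> padic_cells. C \<subseteq> U}"
    proof (intro equalityI subsetI)
      fix x assume "x \<in> U"
      then obtain n where "padic_cell n x \<subseteq> U" using padic_cell_basis[OF \<open>open U\<close>] by blast
      moreover have "padic_cell n x \<in> padic_cells" by (auto simp: padic_cells_def)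
      ultimately show "x \<in> \<Union>{C \<in> padic_cells. C \<subseteq> U}" using padic_cell_self by blast
    qed blast
    moreover have "\<Union>{C \<in> padic_cells. C \<subseteq> U} \<in> sigma_sets UNIV (padic_cells :: 'p padic set set)"
    proof (rule sigma_sets_UNION)
      show "countable {C \<in> padic_cells. C \<subseteq> U}"
        by (rule countable_subset[OF _ countable_padic_cells]) auto
    qed (auto intro: sigma_sets.Basic)
    ultimately show "U \<in> sigma_sets UNIV padic_cells" by simp
  next
    fix C :: "'p padic set" assume "C \<in> padic_cells"
    thus "C \<in> sigma_sets UNIV {S. open S}"
      using padic_cell_open unfolding padic_cells_def by (auto intro: sigma_sets.Basic sigma_sets.Empty)
  qed
qed auto

lemma Int_stable_padic_cells: "Int_stable (padic_cells :: 'p::prime_card padic set set)"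
proof (rule Int_stableI)
  have *: "padic_cell n x \<inter> padic_cell k y \<in> padic_cells" if "k \<le> n" for n k and x y :: "'p padic"
  proof (cases "padic_cell n x \<inter> padic_cell k y = {}")
    case False
    then obtain z where "z \<in> padic_cell n x" "z \<in> padic_cell k y" by blast
    hence "padic_cell n x = padic_cell n z" "padic_cell k y = padic_cell k z" using padic_cell_eq by auto
    hence "padic_cell n x \<inter> padic_cell k y = padic_cell n z"
      using padic_cell_antimono[OF that, of z] by auto
    thus ?thesis by (auto simp: padic_cells_def)
  qed (simp add: padic_cells_def)
  have **: "padic_cell n x \<inter> padic_cell k y \<in> padic_cells" for n k and x y :: "'p padic"
    using *[of k n x y] *[of n k y x] by (cases "k \<le> n") (auto simp: Int_commute)
  fix A B :: "'p padic set" assume AB: "A \<in> padic_cells" "B \<in> padic_cells"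
  show "A \<inter> B \<in> padic_cells"
  proof (cases "A = {} \<or> B = {}")
    case False
    then obtain n x k y where "A = padic_cell n x" "B = padic_cell k y" using AB by (auto simp: padic_cells_def)
    thus ?thesis using ** by simp
  qed (auto simp: padic_cells_def)
qed

lemma sets_borel_padic: "sets (borel :: 'p::prime_card padic measure) = sigma_sets UNIV padic_cells"
  unfolding borel_padic by (rule sets_measure_of) simp

theorem normalized_haar_measure_exists:
  "\<exists>M :: 'p::prime_card padic measure. normalized_haar_measure M"
proof -
  let ?L = "restrict_space lborel {0::real..}"
  let ?f = "monna :: real \<Rightarrow> 'p padic"
  have L: "emeasure ?L {a..<b} = ennreal (b - a)" "{a..<b} \<in> sets ?L" if "0 \<le> a" "a \<le> b" for a b :: real
  proof -
    have sub: "{a..<b} \<subseteq> {0..}" using that by auto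
    show "emeasure ?L {a..<b} = ennreal (b - a)"
      using that sub by (subst emeasure_restrict_space) auto
    show "{a..<b} \<in> sets ?L" using sub by (simp add: sets_restrict_space_iff)
  qed
  have vim: "?f -` padic_cell n (padic_point n m) \<inter> space ?L =
      {real m / real CARD('p) ^ n ..< (real m + 1) / real CARD('p) ^ n}" for n m
    unfolding monna_vimage[symmetric] by (auto simp: space_restrict_space)
  have f [measurable]: "?f \<in> measurable ?L borel"
  proof (rule measurable_sigma_sets)
    show "sets (borel :: 'p padic measure) = sigma_sets UNIV padic_cells"
      by (rule sets_borel_padic)
    fix C :: "'p padic set" assume "C \<in> padic_cells"
    then consider "C = {}" | n x where "C = padic_cell n x" by (auto simp: padic_cells_def)
    thus "?f -` C \<inter> space ?L \<in> sets ?L"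
    proof cases
      case 2
      obtain m where "x \<in> padic_cell n (padic_point n m)" using padic_point_ex by blast
      hence C: "C = padic_cell n (padic_point n m)" using 2 padic_cell_eq by blast
      show ?thesis unfolding C vim by (rule L) (auto simp: divide_right_mono)
    qed simp
  qed auto
  define M where "M = distr ?L borel ?f"
  have sM [measurable_cong, simp]: "sets M = sets borel" by (simp add: M_def)
  have spM [simp]: "space M = UNIV" by (simp add: M_def)
  have cell_sets [measurable, simp]: "padic_cell n (x :: 'p padic) \<in> sets borel" for n x
    using padic_cell_open by (rule borel_open)
  have cell: "emeasure M (padic_cell n x) = ennreal (1 / real CARD('p) ^ n)" for n x
  proof -
    obtain m where "x \<in> padic_cell n (padic_point n m)" using padic_point_ex by blast
    hence C: "padic_cell n x = padic_cell n (padic_point n m)" using padic_cell_eq by blast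
    have "emeasure M (padic_cell n x) = emeasure ?L (?f -` padic_cell n (padic_point n m) \<inter> space ?L)"
      unfolding M_def C by (rule emeasure_distr) auto
    also have "\<dots> = ennreal ((real m + 1) / real CARD('p) ^ n - real m / real CARD('p) ^ n)"
      unfolding vim by (rule L) (auto simp: divide_right_mono)
    also have "(real m + 1) / real CARD('p) ^ n - real m / real CARD('p) ^ n = 1 / real CARD('p) ^ n"
      by (simp add: diff_divide_distrib[symmetric])
    finally show ?thesis .
  qed
  have inv: "emeasure M ((\<lambda>x. a + x) ` A) = emeasure M A" if A: "A \<in> sets borel" for a A
  proof -
    have im: "(\<lambda>x. x - a) -` padic_cell n x = padic_cell n (x + a)" for n and x
      by (auto simp: padic_cell_def algebra_simps)
    have g [measurable]: "(\<lambda>x. x - a) \<in> measurable borel (borel :: 'p padic measure)"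
    proof (rule measurable_sigma_sets)
      show "sets (borel :: 'p padic measure) = sigma_sets UNIV padic_cells"
        by (rule sets_borel_padic)
    qed (auto simp: padic_cells_def im)
    have gM: "(\<lambda>x. x - a) \<in> measurable M (borel :: 'p padic measure)" using g by simp
    define N where "N = distr M borel (\<lambda>x. x - a)"
    have "N = M"
    proof (rule measure_eqI_generator_eq[OF Int_stable_padic_cells, of UNIV _ _ "\<lambda>i. padic_cell 0 (padic_point 0 i)"])
      fix C :: "'p padic set" assume C: "C \<in> padic_cells"
      have "C \<in> sets borel" using C by (auto simp: padic_cells_def)
      hence "emeasure N C = emeasure M ((\<lambda>x. x - a) -` C)"
        unfolding N_def by (simp add: emeasure_distr[OF gM])
      thus "emeasure N C = emeasure M C" using C by (auto simp: padic_cells_def im cell)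
    next
      show "(\<Union>i. padic_cell 0 (padic_point 0 i)) = (UNIV :: 'p padic set)" using padic_point_ex by blast
      show "range (\<lambda>i. padic_cell 0 (padic_point 0 i)) \<subseteq> (padic_cells :: 'p padic set set)"
        by (auto simp: padic_cells_def)
      show "emeasure N (padic_cell 0 (padic_point 0 i)) \<noteq> \<infinity>" for i
        unfolding N_def by (simp add: emeasure_distr[OF gM] im cell)
    qed (simp_all add: N_def sets_borel_padic)
    moreover have "(\<lambda>x. x - a) -` A = (\<lambda>x. a + x) ` A"
    proof (intro equalityI subsetI)
      fix x assume "x \<in> (\<lambda>x. x - a) -` A"
      thus "x \<in> (\<lambda>x. a + x) ` A" by (intro image_eqI[of _ _ "x - a"]) auto
    qed auto
    moreover have "emeasure N A = emeasure M ((\<lambda>x. x - a) -` A)"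
      unfolding N_def using A by (simp add: emeasure_distr[OF gM])
    ultimately show ?thesis by simp
  qed
  have "{x :: 'p padic. padic_norm x \<le> 1} = padic_cell 0 0" by (simp add: padic_cell_def)
  hence "normalized_haar_measure M"
    unfolding normalized_haar_measure_def using inv cell[of 0 0] by simp
  thus ?thesis by blast
qed

subsection \<open>Weighted Lebesgue spaces on the punctured field and the integral operator\<close>

definition punctured :: "'p::prime_card padic measure \<Rightarrow> 'p padic measure" where
  "punctured M = restrict_space M (- {0})"

definition Lq_space :: "'p::prime_card padic measure \<Rightarrow> real \<Rightarrow> real \<Rightarrow> ('p padic \<Rightarrow> real) set" where
  "Lq_space M q alpha = {f \<in> borel_measurable (punctured M).
     integrable (punctured M) (\<lambda>x. \<bar>f x\<bar> powr q * padic_norm x powr alpha)}"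

definition Lq_norm :: "'p::prime_card padic measure \<Rightarrow> real \<Rightarrow> real \<Rightarrow> ('p padic \<Rightarrow> real) \<Rightarrow> real" where
  "Lq_norm M q alpha f =
     (LINT x|punctured M. \<bar>f x\<bar> powr q * padic_norm x powr alpha) powr (1 / q)"

definition Linf_space :: "'p::prime_card padic measure \<Rightarrow> ('p padic \<Rightarrow> real) set" where
  "Linf_space M = {f \<in> borel_measurable (punctured M).
     esssup (punctured M) (\<lambda>x. ereal \<bar>f x\<bar>) < \<infinity>}"

definition Linf_norm :: "'p::prime_card padic measure \<Rightarrow> ('p padic \<Rightarrow> real) \<Rightarrow> real" where
  "Linf_norm M f = real_of_ereal (esssup (punctured M) (\<lambda>x. ereal \<bar>f x\<bar>))"

definition H_kernel :: "real \<Rightarrow> real \<Rightarrow> real \<Rightarrow> 'p::prime_card padic \<Rightarrow> 'p padic \<Rightarrow> real" where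
  "H_kernel lam mu nu x y =
     padic_norm x powr mu * padic_norm y powr nu / max (padic_norm x) (padic_norm y) powr lam"

definition H_op :: "'p::prime_card padic measure \<Rightarrow> real \<Rightarrow> real \<Rightarrow> real \<Rightarrow>
    ('p padic \<Rightarrow> real) \<Rightarrow> 'p padic \<Rightarrow> real" where
  "H_op M lam mu nu f y = (LINT x|punctured M. H_kernel lam mu nu x y * f x)"

text \<open>Integrability in the sense of Bochner is absolute convergence of the integral.\<close>

definition H_bounded :: "'p::prime_card padic measure \<Rightarrow> real \<Rightarrow> real \<Rightarrow> real \<Rightarrow>
    ('p padic \<Rightarrow> real) set \<Rightarrow> (('p padic \<Rightarrow> real) \<Rightarrow> real) \<Rightarrow>
    ('p padic \<Rightarrow> real) set \<Rightarrow> (('p padic \<Rightarrow> real) \<Rightarrow> real) \<Rightarrow> bool" where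
  "H_bounded M lam mu nu X normX Y normY \<longleftrightarrow>
     (\<forall>f\<in>X. AE y in punctured M. integrable (punctured M) (\<lambda>x. H_kernel lam mu nu x y * f x)) \<and>
     (\<exists>C. \<forall>f\<in>X. H_op M lam mu nu f \<in> Y \<and> normY (H_op M lam mu nu f) \<le> C * normX f)"

end

theory Submission
  imports Defs "HOL-Real_Asymp.Real_Asymp"
begin

text \<open>
  Kernel and weight depend on \<open>x\<close> only through \<open>|x| = p\<^sup>k\<close>, and the sphere \<open>|x| = p\<^sup>k\<close> has Haar
  measure \<open>(1 - 1/p) p\<^sup>k\<close>, because a ball is the disjoint union of \<open>p\<close> translates of the next smaller one.
  Sufficiency is Hoelder's inequality for \<open>f(x)|x|\<^bsup>\<alpha>/q\<^esup>\<close> against the kernel times \<open>|x|\<^bsup>-\<alpha>/q\<^esup>\<close>: on the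
  sphere \<open>|x| = p\<^sup>k\<close>, with \<open>|y| = p\<^sup>m\<close>, the \<open>q'\<close>-th power of the latter contributes at most \<open>r\<^bsup>|k-m|\<^esup>\<close>
  where \<open>r = p\<^bsup>-q' min(\<nu>, \<lambda>-\<nu>)\<^esup> < 1\<close>. For necessity, the operator is tested on
  \<open>|x|\<^bsup>-(\<alpha>+1)/q\<^esup>\<close> cut off to a finite set \<open>A\<close> of spheres. A single sphere containing \<open>y\<close> forces
  the homogeneity relation; \<open>N\<close> consecutive spheres inside or outside \<open>|x| = |y| = 1\<close> would give \<open>N = O(N\<^bsup>1/q\<^esup>)\<close> if
  one of the strict inequalities failed.
\<close>

section \<open>Values of the norm and residue digits\<close>

lemma padic_norm_inverse: "padic_norm (inverse x :: 'p::prime_card padic) = inverse (padic_norm x)"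
proof (cases "x = 0")
  case False
  have "padic_norm x * padic_norm (inverse x) = padic_norm (1 :: 'p padic)"
    using False by (simp flip: padic_norm_mult)
  hence "padic_norm x * padic_norm (inverse x) = 1" by (simp add: one_Padic)
  thus ?thesis by (metis inverse_unique)
qed auto

text \<open>A rational within |x|/2 of x has the same norm as x by the ultrametric inequality, and
  the norm of a nonzero rational is a power of p by construction.\<close>

lemma padic_norm_eq_powr:
  assumes "(x :: 'p::prime_card padic) \<noteq> 0"
  obtains k :: int where "padic_norm x = real CARD('p) powr k"
proof -
  have pos: "padic_norm x > 0" using assms by (simp add: order_less_le)
  obtain r where r: "padic_norm (x - Padic (\<lambda>_. r)) \<le> padic_norm x / 2"
    using padic_approx_rat[of "padic_norm x / 2" x] pos by auto
  let ?r = "Padic (\<lambda>_. r) :: 'p padic"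
  have "padic_norm x \<le> max (padic_norm (x - ?r)) (padic_norm ?r)"
    using padic_norm_ultra[of "x - ?r" ?r] by simp
  moreover have "padic_norm ?r \<le> max (padic_norm (x - ?r)) (padic_norm x)"
    using padic_norm_ultra[of "?r - x" x] by (simp add: padic_norm_minus_commute)
  ultimately have eq: "padic_norm x = rat_padic_abs CARD('p) r" using r pos by auto
  hence "r \<noteq> 0" using pos by auto
  hence "padic_norm x = real CARD('p) powr
      (int (multiplicity (int CARD('p)) (snd (quotient_of r))) - int (multiplicity (int CARD('p)) (fst (quotient_of r))))"
    unfolding eq rat_padic_abs_def by (simp flip: powr_real_of_int')
  thus thesis using that by fastforce
qed

text \<open>Since |p| = 1/p, powers of p and of its inverse reach every exponent. Such elements
  scale the unit ball to a ball of any radius p^k.\<close>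

lemma padic_norm_surj_powr:
  obtains u :: "'p::prime_card padic" where "padic_norm u = real CARD('p) powr (k :: int)"
proof -
  let ?p = "of_nat CARD('p) :: 'p padic"
  have pw: "padic_norm (y ^ n) = padic_norm y ^ n" for y :: "'p padic" and n
    by (induction n) (simp_all add: padic_norm_mult one_Padic)
  have P: "real CARD('p) > 0" using CARD_prime_gt_1[where 'p='p] by simp
  show thesis
  proof (cases "k \<ge> 0")
    case True
    have "padic_norm (inverse ?p ^ nat k) = real CARD('p) powr k"
      using True P by (simp add: pw padic_norm_inverse padic_norm_prime powr_real_of_int')
        (simp add: power_int_def)
    thus ?thesis by (rule that)
  next
    case False
    have "padic_norm (?p ^ nat (- k)) = real CARD('p) powr k"
      using False P by (simp add: pw padic_norm_prime powr_real_of_int')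
        (simp add: power_int_def field_simps)
    thus ?thesis by (rule that)
  qed
qed

text \<open>Density reduces this to the digit of a rational r: lying within 1/p of x, r is again in
  the unit ball, and the ultrametric inequality returns from r to x without loss.\<close>

lemma padic_digit:
  assumes "padic_norm (x :: 'p::prime_card padic) \<le> 1"
  obtains d where "d < CARD('p)" "padic_norm (x - of_nat d) \<le> 1 / real CARD('p)"
proof -
  let ?P = "real CARD('p)"
  have P: "?P > 1" by (rule CARD_prime_gt_1)
  obtain r where r: "padic_norm (x - Padic (\<lambda>_. r)) \<le> 1 / ?P"
    using padic_approx_rat[of "1 / ?P" x] P by auto
  let ?r = "Padic (\<lambda>_. r) :: 'p padic"
  have "padic_norm ?r \<le> max (padic_norm (x - ?r)) (padic_norm x)"
    using padic_norm_ultra[of "?r - x" x] by (simp add: padic_norm_minus_commute)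
  also have "\<dots> \<le> 1" using r assms P by (auto intro: order_trans)
  finally have "rat_padic_abs CARD('p) r \<le> 1" by simp
  then obtain d where d: "d < CARD('p)" "rat_padic_abs CARD('p) (r - of_nat d) \<le> 1 / ?P"
    by (rule rat_padic_abs_digit[OF prime_card])
  have "padic_norm (?r - of_nat d) \<le> 1 / ?P"
    using d(2) by (simp add: padic_of_nat diff_Padic)
  hence "padic_norm (x - of_nat d) \<le> 1 / ?P"
    using r padic_norm_ultra_diff[of x "of_nat d" ?r] by auto
  thus thesis using that d(1) by blast
qed

text \<open>The difference is an integer divisible by p and of ordinary absolute value below p,
  hence zero.\<close>

lemma padic_digit_unique:
  assumes "d < CARD('p::prime_card)" "d' < CARD('p)"
    and "padic_norm (of_nat d - of_nat d' :: 'p padic) \<le> 1 / real CARD('p)"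
  shows "d = d'"
proof -
  have "padic_norm (of_nat d - of_nat d' :: 'p padic) = rat_padic_abs CARD('p) (of_int (int d - int d'))"
    by (simp add: padic_of_nat diff_Padic)
  hence "int CARD('p) ^ 1 dvd int d - int d'"
    using assms(3) rat_padic_abs_int_le_iff[OF prime_card[where 'a='p], of "int d - int d'" 1] by simp
  moreover have "\<bar>int d - int d'\<bar> < int CARD('p)" using assms(1,2) by linarith
  ultimately show ?thesis using dvd_imp_le_int[of "int d - int d'" "int CARD('p)"] by fastforce
qed

section \<open>Haar measure of balls and spheres\<close>

definition padic_ball :: "int \<Rightarrow> 'p::prime_card padic set" where
  "padic_ball k = {x. padic_norm x \<le> real CARD('p) powr k}"

definition padic_sphere :: "int \<Rightarrow> 'p::prime_card padic set" where
  "padic_sphere k = {x. padic_norm x = real CARD('p) powr k}"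

text \<open>Division by \<open>u\<close> carries the larger ball to the unit ball, where the residue
  digit modulo p selects the translate; uniqueness of the digit gives disjointness.\<close>

lemma padic_ball_Suc:
  assumes u: "padic_norm (u :: 'p::prime_card padic) = real CARD('p) powr (k + 1 :: int)"
  shows "padic_ball (k + 1) = (\<Union>d<CARD('p). (\<lambda>x. u * of_nat d + x) ` padic_ball k)"
    and "disjoint_family_on (\<lambda>d. (\<lambda>x. u * of_nat d + x) ` padic_ball k) {..<CARD('p)}"
proof -
  let ?P = "real CARD('p)"
  have P: "?P > 1" by (rule CARD_prime_gt_1)
  have u0: "u \<noteq> 0" using u P by auto
  have u': "padic_norm u = ?P powr k * ?P" using u P by (simp add: powr_add)
  \<comment> \<open>Multiplication by \<open>u\<close>, of norm p^(k+1), matches radius 1/p with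
    radius p^k; this transfers both digit lemmas.\<close>
  have scale: "padic_norm (u * z) \<le> ?P powr k \<longleftrightarrow> padic_norm z \<le> 1 / ?P" for z
  proof -
    have "padic_norm (u * z) \<le> ?P powr k \<longleftrightarrow> ?P powr k * (?P * padic_norm z) \<le> ?P powr k * 1"
      by (simp add: padic_norm_mult u' mult.assoc)
    also have "\<dots> \<longleftrightarrow> ?P * padic_norm z \<le> 1" using P by (intro mult_le_cancel_left_pos) simp
    finally show ?thesis using P by (simp add: le_divide_eq mult.commute)
  qed
  show "padic_ball (k + 1) = (\<Union>d<CARD('p). (\<lambda>x. u * of_nat d + x) ` padic_ball k)"
  proof (intro equalityI subsetI)
    fix x :: "'p padic" assume "x \<in> padic_ball (k + 1)"
    hence "padic_norm x / padic_norm u \<le> 1" using P by (simp add: padic_ball_def u)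
    hence "padic_norm (x / u) \<le> 1"
      by (simp add: divide_inverse padic_norm_mult padic_norm_inverse)
    then obtain d where d: "d < CARD('p)" "padic_norm (x / u - of_nat d) \<le> 1 / ?P" by (rule padic_digit)
    hence "padic_norm (x - u * of_nat d) \<le> ?P powr k"
      using scale[of "x / u - of_nat d"] u0 by (simp add: right_diff_distrib)
    hence "x - u * of_nat d \<in> padic_ball k" by (simp add: padic_ball_def)
    thus "x \<in> (\<Union>d<CARD('p). (\<lambda>x. u * of_nat d + x) ` padic_ball k)"
      using d(1) by (intro UN_I[of d] image_eqI[of _ _ "x - u * of_nat d"]) auto
  next
    fix x :: "'p padic" assume "x \<in> (\<Union>d<CARD('p). (\<lambda>x. u * of_nat d + x) ` padic_ball k)"
    then obtain d z where dz: "x = u * of_nat d + z" "padic_norm z \<le> ?P powr k"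
      by (auto simp: padic_ball_def)
    have "padic_norm (of_nat d :: 'p padic) \<le> 1"
      using rat_padic_abs_int_le_1[OF prime_card[where 'a='p], of "int d"] by (simp add: padic_of_nat)
    hence "padic_norm (u * of_nat d) \<le> ?P powr (k + 1 :: int)"
      using P mult_left_mono[of "padic_norm (of_nat d :: 'p padic)" 1 "padic_norm u"]
      by (simp add: padic_norm_mult u)
    moreover have "padic_norm z \<le> ?P powr (k + 1 :: int)"
      by (rule order_trans[OF dz(2)]) (use P in simp)
    ultimately show "x \<in> padic_ball (k + 1)"
      using padic_norm_ultra[of "u * of_nat d" z] by (auto simp: padic_ball_def dz(1))
  qed
  show "disjoint_family_on (\<lambda>d. (\<lambda>x. u * of_nat d + x) ` padic_ball k) {..<CARD('p)}"
    unfolding disjoint_family_on_def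
  proof (intro ballI impI equals0I)
    fix d d' and x :: "'p padic"
    assume d: "d \<in> {..<CARD('p)}" "d' \<in> {..<CARD('p)}" "d \<noteq> d'"
      and "x \<in> (\<lambda>x. u * of_nat d + x) ` padic_ball k \<inter> (\<lambda>x. u * of_nat d' + x) ` padic_ball k"
    then obtain z z' where z: "u * of_nat d + z = u * of_nat d' + z'"
        "padic_norm z \<le> ?P powr k" "padic_norm z' \<le> ?P powr k"
      by (auto simp: padic_ball_def)
    have "u * (of_nat d - of_nat d') = z' - z" using z(1) by (simp add: algebra_simps)
    hence "padic_norm (u * (of_nat d - of_nat d')) \<le> ?P powr k"
      using z(2,3) padic_norm_ultra[of z' "- z"] by auto
    hence "d = d'" using d scale padic_digit_unique by blast
    thus False using d(3) by contradiction
  qed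
qed

lemma borel_measurable_padic_norm [measurable]:
  "padic_norm \<in> borel_measurable (borel :: 'p::prime_card padic measure)"
proof -
  have "(\<lambda>x :: 'p padic. dist x 0) \<in> borel_measurable borel"
    by (intro borel_measurable_continuous_onI continuous_intros)
  thus ?thesis by (simp add: dist_padic_def)
qed

lemma padic_ball_borel [measurable]: "padic_ball k \<in> sets (borel :: 'p::prime_card padic measure)"
  unfolding padic_ball_def by measurable

lemma padic_sphere_borel [measurable]: "padic_sphere k \<in> sets (borel :: 'p::prime_card padic measure)"
  unfolding padic_sphere_def by measurable

text \<open>The normalization settles k = 0; the p disjoint translates have equal measure by
  invariance, so each unit step in k, up or down, changes the measure by a factor p.\<close>

lemma emeasure_padic_ball:
  assumes M: "normalized_haar_measure (M :: 'p::prime_card padic measure)"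
  shows "emeasure M (padic_ball k) = ennreal (real CARD('p) powr k)"
proof -
  let ?P = "real CARD('p)"
  have P: "?P > 1" by (rule CARD_prime_gt_1)
  have sets [measurable_cong, simp]: "sets M = sets borel" using M by (simp add: normalized_haar_measure_def)
  have step: "emeasure M (padic_ball (k + 1)) = ennreal ?P * emeasure M (padic_ball k)" for k
  proof -
    obtain u :: "'p padic" where u: "padic_norm u = ?P powr (k + 1 :: int)" by (rule padic_norm_surj_powr)
    let ?A = "\<lambda>d. (\<lambda>x. u * of_nat d + x) ` padic_ball k"
    have inv: "emeasure M (?A d) = emeasure M (padic_ball k)" for d
      using M unfolding normalized_haar_measure_def by auto
    \<comment> \<open>Recognized as a closed metric ball, the translate is Borel.\<close>
    have "?A d = cball (u * of_nat d) (?P powr k)" for d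
      by (force simp: padic_ball_def dist_padic_def padic_norm_minus_commute[of _ "u * of_nat d"]
          intro: image_eqI[of _ _ "x - u * of_nat d" for x])
    hence "?A d \<in> sets M" for d by simp
    hence "emeasure M (\<Union>d<CARD('p). ?A d) = (\<Sum>d<CARD('p). emeasure M (?A d))"
      using padic_ball_Suc(2)[OF u] by (intro sum_emeasure[symmetric]) auto
    thus ?thesis
      unfolding padic_ball_Suc(1)[OF u] inv by (simp add: ennreal_of_nat_eq_real_of_nat)
  qed
  show ?thesis
  proof (induction k rule: int_induct[where k = 0])
    case base
    show ?case using M P by (simp add: normalized_haar_measure_def padic_ball_def)
  next
    case (step1 k)
    thus ?case using P step[of k] by (simp add: powr_add ennreal_mult' mult.commute)
  next
    case (step2 k)
    \<comment> \<open>Going down, the factor p is finite and nonzero, so it can be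
      cancelled.\<close>
    have "ennreal ?P * emeasure M (padic_ball (k - 1)) = ennreal ?P * ennreal (?P powr (k - 1))"
      using P step2 step[of "k - 1"] by (simp add: powr_diff flip: ennreal_mult')
    thus ?case using P by (simp add: ennreal_mult_cancel_left)
  qed
qed

text \<open>As nonzero norms are integer powers of p, a sphere is the difference of two consecutive
  balls, both of finite measure.\<close>

lemma emeasure_padic_sphere:
  assumes M: "normalized_haar_measure (M :: 'p::prime_card padic measure)"
  shows "emeasure M (padic_sphere k) = ennreal ((1 - 1 / real CARD('p)) * real CARD('p) powr k)"
proof -
  let ?P = "real CARD('p)"
  have P: "?P > 1" by (rule CARD_prime_gt_1)
  have [measurable_cong, simp]: "sets M = sets borel" using M by (simp add: normalized_haar_measure_def)
  have sph: "padic_sphere k = padic_ball k - (padic_ball (k - 1) :: 'p padic set)"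
  proof (intro set_eqI)
    fix x :: "'p padic"
    show "x \<in> padic_sphere k \<longleftrightarrow> x \<in> padic_ball k - padic_ball (k - 1)"
    proof (cases "x = 0")
      case False
      then obtain j :: int where "padic_norm x = ?P powr j" by (rule padic_norm_eq_powr)
      thus ?thesis using P by (auto simp: padic_sphere_def padic_ball_def powr_inj)
    qed (use P in \<open>auto simp: padic_sphere_def padic_ball_def\<close>)
  qed
  have sub: "padic_ball (k - 1) \<subseteq> (padic_ball k :: 'p padic set)"
    using P by (auto simp: padic_ball_def elim!: order_trans)
  have "emeasure M (padic_sphere k) = emeasure M (padic_ball k) - emeasure M (padic_ball (k - 1))"
    unfolding sph by (rule emeasure_Diff) (use sub in \<open>auto simp: emeasure_padic_ball[OF M]\<close>)
  also have "\<dots> = ennreal (?P powr k - ?P powr (k - 1))"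
    by (simp add: emeasure_padic_ball[OF M] ennreal_minus)
  also have "?P powr k - ?P powr (k - 1) = (1 - 1 / ?P) * ?P powr k"
    using P by (simp add: powr_diff field_simps)
  finally show ?thesis .
qed

section \<open>Radial integrals as sums over the integers\<close>

text \<open>At nonzero x the logarithm is already an integer and the floor only changes the type; at
  0, outside the punctured space, the value is a default.\<close>

definition padic_log :: "'p::prime_card padic \<Rightarrow> int" where
  "padic_log x = \<lfloor>log (real CARD('p)) (padic_norm x)\<rfloor>"

lemma padic_log_eq:
  "padic_norm (x :: 'p::prime_card padic) = real CARD('p) powr (k :: int) \<Longrightarrow> padic_log x = k"
  using CARD_prime_gt_1[where 'p='p] by (simp add: padic_log_def)

lemma padic_norm_eq_powr_log:
  assumes "(x :: 'p::prime_card padic) \<noteq> 0"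
  shows "padic_norm x = real CARD('p) powr padic_log x"
  using padic_norm_eq_powr[OF assms] padic_log_eq by metis

lemma measurable_padic_log [measurable]:
  "padic_log \<in> measurable (borel :: 'p::prime_card padic measure) (count_space UNIV)"
  unfolding padic_log_def by measurable

lemma space_punctured:
  "normalized_haar_measure (M :: 'p::prime_card padic measure) \<Longrightarrow> space (punctured M) = - {0}"
  using sets_eq_imp_space_eq[of M borel]
  by (simp add: punctured_def space_restrict_space normalized_haar_measure_def)

lemma measurable_punctured:
  "normalized_haar_measure (M :: 'p::prime_card padic measure) \<Longrightarrow> f \<in> measurable borel N \<Longrightarrow>
    f \<in> measurable (punctured M) N"
  unfolding punctured_def normalized_haar_measure_def
  by (intro measurable_restrict_space1) (simp cong: measurable_cong_sets)

lemma padic_sphere_punctured: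
  assumes M: "normalized_haar_measure (M :: 'p::prime_card padic measure)"
  shows "padic_sphere k \<in> sets (punctured M)"
    and "emeasure (punctured M) (padic_sphere k) = ennreal ((1 - 1 / real CARD('p)) * real CARD('p) powr k)"
proof -
  have sp [simp]: "space M = UNIV" "sets M = sets borel"
    using M sets_eq_imp_space_eq[of M borel] by (auto simp: normalized_haar_measure_def)
  have sub: "padic_sphere k \<subseteq> (- {0} :: 'p padic set)"
    using CARD_prime_gt_1[where 'p='p] by (auto simp: padic_sphere_def)
  have 0: "- {0 :: 'p padic} \<in> sets borel" by (simp add: borel_open open_Compl)
  show "padic_sphere k \<in> sets (punctured M)"
    unfolding punctured_def using sub 0 by (simp add: sets_restrict_space_iff)
  show "emeasure (punctured M) (padic_sphere k) = ennreal ((1 - 1 / real CARD('p)) * real CARD('p) powr k)"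
    unfolding punctured_def using sub 0
    by (subst emeasure_restrict_space) (simp_all add: emeasure_padic_sphere[OF M])
qed

text \<open>Point masses determine a measure on a countable space, and the fibre over k is the
  sphere of radius p^k. Integrals of functions of |x| thereby become weighted sums over k.\<close>

lemma distr_padic_log:
  assumes M: "normalized_haar_measure (M :: 'p::prime_card padic measure)"
  shows "distr (punctured M) (count_space UNIV) padic_log =
    density (count_space UNIV) (\<lambda>k. ennreal ((1 - 1 / real CARD('p)) * real CARD('p) powr k))"
proof (rule measure_eqI_countable[where A = UNIV])
  fix k :: int
  have v: "padic_log \<in> measurable (punctured M) (count_space UNIV)"
    by (rule measurable_punctured[OF M]) measurable
  have "padic_log -` {k} \<inter> space (punctured M) = (padic_sphere k :: 'p padic set)"
  proof (intro set_eqI iffI)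
    fix x :: "'p padic" assume "x \<in> padic_log -` {k} \<inter> space (punctured M)"
    hence "x \<noteq> 0" "padic_log x = k" by (auto simp: space_punctured[OF M])
    thus "x \<in> padic_sphere k" using padic_norm_eq_powr_log[of x] by (simp add: padic_sphere_def)
  next
    fix x :: "'p padic" assume x: "x \<in> padic_sphere k"
    hence "x \<noteq> 0" using CARD_prime_gt_1[where 'p='p] by (auto simp: padic_sphere_def)
    thus "x \<in> padic_log -` {k} \<inter> space (punctured M)"
      using x padic_log_eq[of x k] by (simp add: padic_sphere_def space_punctured[OF M])
  qed
  thus "emeasure (distr (punctured M) (count_space UNIV) padic_log) {k} =
      emeasure (density (count_space UNIV) (\<lambda>k. ennreal ((1 - 1 / real CARD('p)) * real CARD('p) powr k))) {k}"
    by (simp add: emeasure_distr[OF v] padic_sphere_punctured[OF M] emeasure_density)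
qed auto

lemma nn_integral_padic_log:
  assumes M: "normalized_haar_measure (M :: 'p::prime_card padic measure)"
  shows "(\<integral>\<^sup>+x. g (padic_log x) \<partial>punctured M) =
    (\<integral>\<^sup>+k. ennreal ((1 - 1 / real CARD('p)) * real CARD('p) powr k) * g k \<partial>count_space UNIV)"
proof -
  have v: "padic_log \<in> measurable (punctured M) (count_space UNIV)"
    by (rule measurable_punctured[OF M]) measurable
  have "(\<integral>\<^sup>+x. g (padic_log x) \<partial>punctured M) =
      (\<integral>\<^sup>+k. g k \<partial>distr (punctured M) (count_space UNIV) padic_log)"
    by (rule nn_integral_distr[OF v, symmetric]) simp
  thus ?thesis unfolding distr_padic_log[OF M] by (simp add: nn_integral_density)
qed

text \<open>Evaluates the integrals of test functions supported on finitely many spheres.\<close>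

lemma has_bochner_integral_padic_log_finite:
  fixes g :: "int \<Rightarrow> real"
  assumes M: "normalized_haar_measure (M :: 'p::prime_card padic measure)"
    and A: "finite A" and g: "\<And>k. k \<in> A \<Longrightarrow> g k \<ge> 0" and g0: "\<And>k. k \<notin> A \<Longrightarrow> g k = 0"
  shows "has_bochner_integral (punctured M) (\<lambda>x. g (padic_log x))
    (\<Sum>k\<in>A. (1 - 1 / real CARD('p)) * real CARD('p) powr k * g k)"
proof (rule has_bochner_integral_nn_integral)
  let ?w = "\<lambda>k::int. (1 - 1 / real CARD('p)) * real CARD('p) powr k"
  have w: "?w k \<ge> 0" for k using CARD_prime_gt_1[where 'p='p] by simp
  have g': "g k \<ge> 0" for k using g g0 by (cases "k \<in> A") auto
  show "(\<lambda>x. g (padic_log x)) \<in> borel_measurable (punctured M)"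
    by (rule measurable_punctured[OF M]) measurable
  show "AE x in punctured M. 0 \<le> g (padic_log x)" using g' by simp
  show "0 \<le> (\<Sum>k\<in>A. ?w k * g k)" using w g' by (intro sum_nonneg mult_nonneg_nonneg) auto
  have "(\<integral>\<^sup>+x. ennreal (g (padic_log x)) \<partial>punctured M) = (\<integral>\<^sup>+k. ennreal (?w k * g k) \<partial>count_space UNIV)"
    unfolding nn_integral_padic_log[OF M, of "\<lambda>k. ennreal (g k)"]
    by (intro nn_integral_cong ennreal_mult[symmetric] w g')
  also have "\<dots> = (\<Sum>k\<in>A. ennreal (?w k * g k))"
    by (rule nn_integral_count_space'[OF A]) (auto simp: g0)
  also have "\<dots> = ennreal (\<Sum>k\<in>A. ?w k * g k)" using w g' by (simp add: sum_ennreal)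
  finally show "(\<integral>\<^sup>+x. ennreal (g (padic_log x)) \<partial>punctured M) = ennreal (\<Sum>k\<in>A. ?w k * g k)" .
qed

text \<open>After a shift by m, the integers are covered by n and -n for natural n, each half giving
  a geometric series.\<close>

lemma nn_integral_geometric_int:
  fixes r :: real
  assumes "0 \<le> r" "r < 1"
  shows "(\<integral>\<^sup>+k. ennreal (r ^ nat \<bar>k - m\<bar>) \<partial>count_space (UNIV :: int set)) \<le> ennreal (2 / (1 - r))"
proof -
  have side: "(\<integral>\<^sup>+k. ennreal (r ^ nat \<bar>k\<bar>) * indicator (range s) k \<partial>count_space UNIV) = ennreal (1 / (1 - r))"
    if "inj s" "\<And>n. nat \<bar>s n\<bar> = n" for s :: "nat \<Rightarrow> int"
  proof -
    have "(\<integral>\<^sup>+k. ennreal (r ^ nat \<bar>k\<bar>) * indicator (range s) k \<partial>count_space UNIV) =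
        (\<integral>\<^sup>+k. ennreal (r ^ nat \<bar>k\<bar>) \<partial>count_space (range s))"
      by (simp add: nn_integral_restrict_space[symmetric] restrict_count_space)
    also have "\<dots> = (\<integral>\<^sup>+n. ennreal (r ^ nat \<bar>s n\<bar>) \<partial>count_space UNIV)"
      using that(1) by (intro nn_integral_bij_count_space[symmetric]) (simp add: bij_betw_def)
    also have "\<dots> = (\<Sum>n. ennreal (r ^ n))" by (simp add: that(2) nn_integral_count_space_nat)
    also have "\<dots> = ennreal (1 / (1 - r))"
      using assms by (subst suminf_ennreal2) (auto simp: summable_geometric suminf_geometric)
    finally show ?thesis .
  qed
  have "(\<integral>\<^sup>+k. ennreal (r ^ nat \<bar>k - m\<bar>) \<partial>count_space UNIV) = (\<integral>\<^sup>+k. ennreal (r ^ nat \<bar>k\<bar>) \<partial>count_space UNIV)"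
    by (rule nn_integral_bij_count_space[of "\<lambda>k. k - m", where f = "\<lambda>k. ennreal (r ^ nat \<bar>k\<bar>)"])
       (auto intro!: bij_betwI[where g = "\<lambda>k. k + m"])
  \<comment> \<open>Only an inequality, since k = 0 belongs to both halves.\<close>
  also have "\<dots> \<le> (\<integral>\<^sup>+k. ennreal (r ^ nat \<bar>k\<bar>) * indicator (range int) k +
      ennreal (r ^ nat \<bar>k\<bar>) * indicator (range (\<lambda>n. - int n)) k \<partial>count_space UNIV)"
  proof (rule nn_integral_mono)
    fix k :: int
    have "k \<in> range int \<or> k \<in> range (\<lambda>n. - int n)"
      by (cases k rule: int_cases2) auto
    thus "ennreal (r ^ nat \<bar>k\<bar>) \<le> ennreal (r ^ nat \<bar>k\<bar>) * indicator (range int) k +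
      ennreal (r ^ nat \<bar>k\<bar>) * indicator (range (\<lambda>n. - int n)) k"
      by (auto simp: indicator_def)
  qed
  also have "\<dots> = ennreal (1 / (1 - r)) + ennreal (1 / (1 - r))"
    by (subst nn_integral_add) (simp_all add: side inj_def)
  also have "\<dots> = ennreal (2 / (1 - r))"
    using assms by (simp flip: ennreal_plus)
  finally show ?thesis .
qed

text \<open>The factor 1 - 1/p of the sphere measure is bounded by 1, which leaves the two-sided
  geometric series. The bound is independent of the centre m, and this makes the later estimate
  uniform in y.\<close>

lemma integral_padic_log_le:
  fixes g :: "int \<Rightarrow> real"
  assumes M: "normalized_haar_measure (M :: 'p::prime_card padic measure)"
    and r: "0 \<le> r" "r < 1" and g: "\<And>k. g k \<ge> 0"
    and le: "\<And>k. real CARD('p) powr k * g k \<le> r ^ nat \<bar>k - m\<bar>"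
  shows "integrable (punctured M) (\<lambda>x. g (padic_log x))"
    and "(LINT x|punctured M. g (padic_log x)) \<le> 2 / (1 - r)"
proof -
  let ?P = "real CARD('p)"
  have P: "?P > 1" by (rule CARD_prime_gt_1)
  have meas: "(\<lambda>x. g (padic_log x)) \<in> borel_measurable (punctured M)"
    by (rule measurable_punctured[OF M]) measurable
  have "(1 - 1 / ?P) * ?P powr k * g k \<le> r ^ nat \<bar>k - m\<bar>" for k
  proof -
    have "(1 - 1 / ?P) * (?P powr k * g k) \<le> 1 * (?P powr k * g k)"
      using P g by (intro mult_right_mono) auto
    also have "\<dots> \<le> r ^ nat \<bar>k - m\<bar>" using le[of k] by simp
    finally show ?thesis by (simp only: mult.assoc)
  qed
  hence "ennreal ((1 - 1 / ?P) * ?P powr k) * ennreal (g k) \<le> ennreal (r ^ nat \<bar>k - m\<bar>)" for k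
    using P g by (subst ennreal_mult[symmetric]) (auto intro: ennreal_leI)
  hence "(\<integral>\<^sup>+x. ennreal (g (padic_log x)) \<partial>punctured M) \<le> (\<integral>\<^sup>+k. ennreal (r ^ nat \<bar>k - m\<bar>) \<partial>count_space UNIV)"
    unfolding nn_integral_padic_log[OF M, of "\<lambda>k. ennreal (g k)"] by (intro nn_integral_mono)
  also note nn_integral_geometric_int[OF r]
  finally have nn: "(\<integral>\<^sup>+x. ennreal (g (padic_log x)) \<partial>punctured M) \<le> ennreal (2 / (1 - r))" .
  show int: "integrable (punctured M) (\<lambda>x. g (padic_log x))"
    using meas g le_less_trans[OF nn] by (intro integrableI_bounded) (auto simp: abs_of_nonneg)
  have "ennreal (LINT x|punctured M. g (padic_log x)) \<le> ennreal (2 / (1 - r))"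
    using nn nn_integral_eq_integral[OF int] g by simp
  thus "(LINT x|punctured M. g (padic_log x)) \<le> 2 / (1 - r)"
    using r by (simp add: ennreal_le_iff)
qed

section \<open>Hoelder's inequality\<close>

text \<open>Young's inequality, applied pointwise, dominates the product by an integrable function;
  applied again after dividing f and g by their norms, it integrates to 1/p + 1/q = 1.\<close>

lemma Holder_inequality:
  fixes f g :: "'a \<Rightarrow> real"
  assumes pq: "p > 1" "q > 1" "1 / p + 1 / q = 1"
    and [measurable]: "f \<in> borel_measurable M" "g \<in> borel_measurable M"
    and f: "integrable M (\<lambda>x. \<bar>f x\<bar> powr p)" and g: "integrable M (\<lambda>x. \<bar>g x\<bar> powr q)"
  shows "integrable M (\<lambda>x. f x * g x)"
    and "(LINT x|M. \<bar>f x * g x\<bar>) \<le>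
      (LINT x|M. \<bar>f x\<bar> powr p) powr (1 / p) * (LINT x|M. \<bar>g x\<bar> powr q) powr (1 / q)"
proof -
  show fg: "integrable M (\<lambda>x. f x * g x)"
  proof (rule Bochner_Integration.integrable_bound)
    show "integrable M (\<lambda>x. \<bar>f x\<bar> powr p / p + \<bar>g x\<bar> powr q / q)" using f g by simp
    show "AE x in M. norm (f x * g x) \<le> norm (\<bar>f x\<bar> powr p / p + \<bar>g x\<bar> powr q / q)"
      using Youngs_inequality[OF pq, of "\<bar>f _\<bar>" "\<bar>g _\<bar>"] pq by (auto simp: abs_mult)
  qed simp
  let ?F = "LINT x|M. \<bar>f x\<bar> powr p" and ?G = "LINT x|M. \<bar>g x\<bar> powr q"
  let ?a = "?F powr (1 / p)" and ?b = "?G powr (1 / q)"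
  have nn: "?F \<ge> 0" "?G \<ge> 0" by simp_all
  show "(LINT x|M. \<bar>f x * g x\<bar>) \<le> ?a * ?b"
  proof (cases "?F = 0 \<or> ?G = 0")
    \<comment> \<open>Normalization is impossible when a norm vanishes; then one factor is zero
      almost everywhere, and so is the product.\<close>
    case True
    have "AE x in M. \<bar>f x * g x\<bar> = 0"
      using True
    proof
      assume "?F = 0"
      hence "AE x in M. \<bar>f x\<bar> powr p = 0" using f by (subst (asm) integral_nonneg_eq_0_iff_AE) auto
      thus ?thesis by eventually_elim simp
    next
      assume "?G = 0"
      hence "AE x in M. \<bar>g x\<bar> powr q = 0" using g by (subst (asm) integral_nonneg_eq_0_iff_AE) auto
      thus ?thesis by eventually_elim simp
    qed
    hence "(LINT x|M. \<bar>f x * g x\<bar>) = 0" by (rule integral_eq_zero_AE)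
    thus ?thesis by simp
  next
    case False
    hence FG: "?F > 0" "?G > 0" using nn by (auto simp: order_less_le)
    hence ab: "?a > 0" "?b > 0" by auto
    have pw: "?a powr p = ?F" "?b powr q = ?G" using FG pq by (simp_all add: powr_powr)
    have "(LINT x|M. \<bar>f x * g x\<bar> / (?a * ?b)) \<le> (LINT x|M. \<bar>f x\<bar> powr p / ?F / p + \<bar>g x\<bar> powr q / ?G / q)"
    proof (rule integral_mono)
      fix x
      have "\<bar>f x\<bar> / ?a * (\<bar>g x\<bar> / ?b) \<le> (\<bar>f x\<bar> / ?a) powr p / p + (\<bar>g x\<bar> / ?b) powr q / q"
        using ab by (intro Youngs_inequality[OF pq]) auto
      thus "\<bar>f x * g x\<bar> / (?a * ?b) \<le> \<bar>f x\<bar> powr p / ?F / p + \<bar>g x\<bar> powr q / ?G / q"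
        by (simp add: powr_divide pw abs_mult)
    qed (use fg f g in auto)
    also have "\<dots> = (LINT x|M. \<bar>f x\<bar> powr p / ?F / p) + (LINT x|M. \<bar>g x\<bar> powr q / ?G / q)"
      using f g by (intro Bochner_Integration.integral_add) auto
    also have "\<dots> = 1" using FG pq(3) by simp
    finally have "(LINT x|M. \<bar>f x * g x\<bar>) / (?a * ?b) \<le> 1" by simp
    thus ?thesis using mult_pos_pos[OF ab] by (simp only: divide_le_eq_1_pos)
  qed
qed

section \<open>The kernel and sufficiency\<close>

text \<open>Written as one power of p, the kernel turns the later estimates into comparisons of
  exponents; \<open>max\<close> passes to the exponent by monotonicity.\<close>

lemma H_kernel_eq_powr:
  fixes lam mu nu :: real
  assumes "x \<noteq> 0" "y \<noteq> (0 :: 'p::prime_card padic)"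
  shows "H_kernel lam mu nu x y = real CARD('p) powr
    (padic_log x * mu + padic_log y * nu - lam * max (padic_log x) (padic_log y))"
proof -
  let ?P = "real CARD('p)"
  have P: "?P > 1" by (rule CARD_prime_gt_1)
  have "max (?P powr padic_log x) (?P powr padic_log y) = ?P powr max (padic_log x) (padic_log y)"
    using P by (cases "padic_log x \<le> padic_log y") (auto simp: max_def)
  thus ?thesis
    unfolding H_kernel_def padic_norm_eq_powr_log[OF assms(1)] padic_norm_eq_powr_log[OF assms(2)]
    by (simp only: powr_powr powr_add powr_diff mult.commute[of lam])
qed

lemma measurable_H_kernel:
  assumes M: "normalized_haar_measure (M :: 'p::prime_card padic measure)"
  shows "(\<lambda>x. H_kernel lam mu nu x y) \<in> borel_measurable (punctured M)"
  by (rule measurable_punctured[OF M]) (simp add: H_kernel_def)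

text \<open>The value at y depends on y only through \<open>padic_log y\<close>, and every function
  on the discrete space of integers is measurable.\<close>

lemma measurable_H_op:
  assumes M: "normalized_haar_measure (M :: 'p::prime_card padic measure)"
  shows "H_op M lam mu nu f \<in> borel_measurable (punctured M)"
proof -
  define h where "h m = (LINT x|punctured M. real CARD('p) powr
      (padic_log x * mu + m * nu - lam * max (padic_log x) m) * f x)" for m :: int
  have "H_op M lam mu nu f y = h (padic_log y)" if "y \<in> space (punctured M)" for y
    unfolding H_op_def h_def using that
    by (intro Bochner_Integration.integral_cong) (auto simp: space_punctured[OF M] H_kernel_eq_powr)
  moreover have "(\<lambda>y. h (padic_log y)) \<in> borel_measurable (punctured M)"
    by (rule measurable_punctured[OF M]) measurable
  ultimately show ?thesis by (simp cong: measurable_cong)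
qed

text \<open>The left side collects the sphere weight p^k and the q'-th power of the weighted kernel.
  By homogeneity it equals -q'(\<lambda>-\<nu>)(m-k) for k \<le> m and -q'\<nu>(k-m) for k > m,
  which explains the minimum.\<close>

lemma H_kernel_exponent_le:
  fixes k m :: int and q lam mu nu alpha :: real
  assumes q: "1 < q" and hom: "lam = mu + nu + 1 - (alpha + 1) / q"
  defines "q' \<equiv> q / (q - 1)"
  shows "k + q' * (k * mu + m * nu - lam * max k m - k * alpha / q) \<le> - (q' * min nu (lam - nu)) * \<bar>k - m\<bar>"
proof -
  have q': "q' > 0" "q' * (1 - 1 / q) = 1" using q by (auto simp: q'_def field_simps)
  \<comment> \<open>As q'(1 - 1/q) = 1, the k from the sphere weight moves inside the factor
    q'.\<close>
  have "k + q' * (k * mu + m * nu - lam * max k m - k * alpha / q) =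
      q' * (k * (1 - 1 / q) + (k * mu + m * nu - lam * max k m - k * alpha / q))"
    using q'(2) by (simp add: distrib_left mult.left_commute[of q'])
  also have "k * (1 - 1 / q) + (k * mu + m * nu - lam * max k m - k * alpha / q) =
      k * (lam - nu) + m * nu - lam * max k m"
    unfolding hom by (simp add: algebra_simps add_divide_distrib)
  also have "\<dots> \<le> - min nu (lam - nu) * \<bar>k - m\<bar>"
  proof (cases "k \<le> m")
    case True
    have "min nu (lam - nu) * (m - k) \<le> (lam - nu) * (m - k)" using True by (intro mult_right_mono) auto
    thus ?thesis using True by (simp add: max_def algebra_simps)
  next
    case False
    have "min nu (lam - nu) * (k - m) \<le> nu * (k - m)" using False by (intro mult_right_mono) auto
    thus ?thesis using False by (simp add: max_def algebra_simps)
  qed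
  finally show ?thesis using q'(1) by (simp add: mult.assoc)
qed

text \<open>Hoelder's inequality bounds every nonzero y by one constant, because the kernel factor
  has a norm bound depending on neither f nor y.\<close>

lemma H_op_pointwise_bound:
  fixes q lam mu nu alpha :: real
  assumes M: "normalized_haar_measure (M :: 'p::prime_card padic measure)"
    and q: "1 < q" and hom: "lam = mu + nu + 1 - (alpha + 1) / q" and nu: "0 < nu" "nu < lam"
  obtains C where "C \<ge> 0"
    "\<And>f y. f \<in> Lq_space M q alpha \<Longrightarrow> y \<noteq> 0 \<Longrightarrow>
       integrable (punctured M) (\<lambda>x. H_kernel lam mu nu x y * f x)"
    "\<And>f y. f \<in> Lq_space M q alpha \<Longrightarrow> y \<noteq> 0 \<Longrightarrow> \<bar>H_op M lam mu nu f y\<bar> \<le> C * Lq_norm M q alpha f"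
proof -
  let ?P = "real CARD('p)"
  have P: "?P > 1" by (rule CARD_prime_gt_1)
  define q' where "q' = q / (q - 1)"
  have q': "q' > 1" "1 / q' + 1 / q = 1" using q by (auto simp: q'_def field_simps)
  define r where "r = ?P powr (- (q' * min nu (lam - nu)))"
  have "q' * min nu (lam - nu) > 0" using q' nu by simp
  hence r: "0 \<le> r" "r < 1" using P by (auto simp: r_def powr_less_one)
  define C where "C = (2 / (1 - r)) powr (1 / q')"
  have main: "integrable (punctured M) (\<lambda>x. H_kernel lam mu nu x y * f x) \<and>
      \<bar>H_op M lam mu nu f y\<bar> \<le> C * Lq_norm M q alpha f"
    if f: "f \<in> Lq_space M q alpha" and y: "y \<noteq> 0" for f and y :: "'p padic"
  proof -
    define m where "m = padic_log y"
    \<comment> \<open>The weight is split so that |b|^q is exactly the integrand of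
      \<open>Lq_norm\<close>, while |a|^q' depends on x only through \<open>padic_log x\<close>, as
      recorded by \<open>g\<close>.\<close>
    define a where "a x = H_kernel lam mu nu x y * padic_norm x powr (- alpha / q)" for x
    define b where "b x = f x * padic_norm x powr (alpha / q)" for x
    define g where "g k = ?P powr (q' * (k * mu + m * nu - lam * max k m - k * alpha / q))" for k :: int
    have N [measurable]: "padic_norm \<in> borel_measurable (punctured M)"
      by (rule measurable_punctured[OF M]) measurable
    have fm [measurable]: "f \<in> borel_measurable (punctured M)" using f by (simp add: Lq_space_def)
    note [measurable] = measurable_H_kernel[OF M]
    have a_meas: "a \<in> borel_measurable (punctured M)" unfolding a_def[abs_def] by measurable
    have b_meas: "b \<in> borel_measurable (punctured M)" unfolding b_def[abs_def] by measurable
    have a: "\<bar>a x\<bar> powr q' = g (padic_log x)" if "x \<in> space (punctured M)" for x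
    proof -
      have "x \<noteq> 0" using that by (simp add: space_punctured[OF M])
      hence "a x = ?P powr (padic_log x * mu + m * nu - lam * max (padic_log x) m - padic_log x * alpha / q)"
        using y by (simp add: a_def H_kernel_eq_powr m_def padic_norm_eq_powr_log[of x] powr_powr flip: powr_add)
      thus ?thesis by (simp add: g_def powr_powr mult.commute)
    qed
    have b: "\<bar>b x\<bar> powr q = \<bar>f x\<bar> powr q * padic_norm x powr alpha" for x
      using q by (simp add: b_def abs_mult powr_mult powr_powr)
    have ab: "H_kernel lam mu nu x y * f x = a x * b x" if "x \<in> space (punctured M)" for x
    proof -
      have "x \<noteq> 0" using that by (simp add: space_punctured[OF M])
      hence "padic_norm x powr (- alpha / q) * padic_norm x powr (alpha / q) = 1"
        by (simp flip: powr_add)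
      thus ?thesis by (simp add: a_def b_def)
    qed
    have "?P powr k * g k \<le> r ^ nat \<bar>k - m\<bar>" for k
    proof -
      have "?P powr k * g k \<le> ?P powr (- (q' * min nu (lam - nu)) * \<bar>k - m\<bar>)"
        using H_kernel_exponent_le[OF q hom, of k m] P by (simp add: g_def q'_def flip: powr_add)
      also have "\<dots> = r powr real (nat \<bar>k - m\<bar>)" by (simp add: r_def powr_powr)
      also have "\<dots> = r ^ nat \<bar>k - m\<bar>" using P by (intro powr_realpow) (simp add: r_def)
      finally show ?thesis .
    qed
    note g = integral_padic_log_le[OF M r _ this]
    have a_int: "integrable (punctured M) (\<lambda>x. \<bar>a x\<bar> powr q')"
      using g(1) a by (simp add: g_def cong: Bochner_Integration.integrable_cong)
    have a_le: "(LINT x|punctured M. \<bar>a x\<bar> powr q') \<le> 2 / (1 - r)"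
      using g(2) a by (simp add: g_def cong: Bochner_Integration.integral_cong)
    have b_int: "integrable (punctured M) (\<lambda>x. \<bar>b x\<bar> powr q)"
      using f by (simp add: b Lq_space_def)
    note H = Holder_inequality[OF q'(1) q q'(2) a_meas b_meas a_int b_int]
    have int: "integrable (punctured M) (\<lambda>x. H_kernel lam mu nu x y * f x)"
      using H(1) ab by (simp cong: Bochner_Integration.integrable_cong)
    have "H_op M lam mu nu f y = (LINT x|punctured M. a x * b x)"
      unfolding H_op_def using ab by (intro Bochner_Integration.integral_cong) auto
    hence "\<bar>H_op M lam mu nu f y\<bar> \<le> (LINT x|punctured M. \<bar>a x * b x\<bar>)"
      by simp
    also note H(2)
    also have "(LINT x|punctured M. \<bar>b x\<bar> powr q) powr (1 / q) = Lq_norm M q alpha f"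
      by (simp add: b Lq_norm_def)
    also have "(LINT x|punctured M. \<bar>a x\<bar> powr q') powr (1 / q') * Lq_norm M q alpha f \<le> C * Lq_norm M q alpha f"
      unfolding C_def using a_le q' by (intro mult_right_mono powr_mono2) (auto simp: Lq_norm_def)
    finally show ?thesis using int by blast
  qed
  show thesis
    using that[of C] main by (auto simp: C_def)
qed

lemma H_bounded_Linf_sufficient:
  fixes q lam mu nu alpha :: real
  assumes M: "normalized_haar_measure (M :: 'p::prime_card padic measure)"
    and q: "1 < q" and hom: "lam = mu + nu + 1 - (alpha + 1) / q" and nu: "0 < nu" "nu < lam"
  shows "H_bounded M lam mu nu (Lq_space M q alpha) (Lq_norm M q alpha) (Linf_space M) (Linf_norm M)"
proof -
  obtain C where C: "C \<ge> 0"
    "\<And>f y. f \<in> Lq_space M q alpha \<Longrightarrow> y \<noteq> 0 \<Longrightarrow>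
       integrable (punctured M) (\<lambda>x. H_kernel lam mu nu x y * f x)"
    "\<And>f y. f \<in> Lq_space M q alpha \<Longrightarrow> y \<noteq> 0 \<Longrightarrow> \<bar>H_op M lam mu nu f y\<bar> \<le> C * Lq_norm M q alpha f"
    by (rule H_op_pointwise_bound[OF assms]) blast
  have "H_op M lam mu nu f \<in> Linf_space M \<and> Linf_norm M (H_op M lam mu nu f) \<le> C * Lq_norm M q alpha f"
    if f: "f \<in> Lq_space M q alpha" for f
  proof -
    let ?e = "esssup (punctured M) (\<lambda>x. ereal \<bar>H_op M lam mu nu f x\<bar>)"
    note [measurable] = measurable_H_op[OF M]
    have le: "?e \<le> ereal (C * Lq_norm M q alpha f)"
    proof (rule esssup_I)
      show "AE x in punctured M. ereal \<bar>H_op M lam mu nu f x\<bar> \<le> ereal (C * Lq_norm M q alpha f)"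
        using C(3)[OF f] by (intro AE_I2) (simp add: space_punctured[OF M])
    qed measurable
    \<comment> \<open>Nonnegativity covers the formal case of essential supremum minus infinity,
      which \<open>real_of_ereal\<close> sends to 0.\<close>
    have "C * Lq_norm M q alpha f \<ge> 0" using C(1) by (simp add: Lq_norm_def)
    hence "real_of_ereal ?e \<le> C * Lq_norm M q alpha f"
      using le by (cases ?e) auto
    moreover have "?e < \<infinity>" using le by (rule le_less_trans) simp
    ultimately show ?thesis by (simp add: Linf_space_def Linf_norm_def measurable_H_op[OF M])
  qed
  moreover have "AE y in punctured M. integrable (punctured M) (\<lambda>x. H_kernel lam mu nu x y * f x)"
    if "f \<in> Lq_space M q alpha" for f
    using C(2)[OF that] by (intro AE_I2) (simp add: space_punctured[OF M])
  ultimately show ?thesis unfolding H_bounded_def by blast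
qed

section \<open>Necessity by test functions\<close>

text \<open>A sphere has positive measure, so a bound valid almost everywhere holds at one of its
  points. This extracts pointwise information at a prescribed |y| from the essential
  supremum.\<close>

lemma abs_le_Linf_norm_on_sphere:
  assumes M: "normalized_haar_measure (M :: 'p::prime_card padic measure)" and h: "h \<in> Linf_space M"
  obtains y where "y \<in> padic_sphere m" "\<bar>h y\<bar> \<le> Linf_norm M h"
proof -
  let ?e = "esssup (punctured M) (\<lambda>x. ereal \<bar>h x\<bar>)"
  have P: "real CARD('p) > 1" by (rule CARD_prime_gt_1)
  have "\<exists>y\<in>padic_sphere m. ereal \<bar>h y\<bar> \<le> ?e"
  proof (rule ccontr)
    assume neg: "\<not> (\<exists>y\<in>padic_sphere m. ereal \<bar>h y\<bar> \<le> ?e)"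
    have "AE y in punctured M. ereal \<bar>h y\<bar> \<le> ?e" by (rule esssup_AE)
    hence "AE y in punctured M. y \<notin> padic_sphere m" by eventually_elim (use neg in blast)
    hence "emeasure (punctured M) (padic_sphere m) = 0"
      using AE_iff_null_sets[OF padic_sphere_punctured(1)[OF M, of m]] by auto
    thus False using P by (simp add: padic_sphere_punctured(2)[OF M] ennreal_eq_0_iff mult_le_0_iff)
  qed
  then obtain y where y: "y \<in> padic_sphere m" "ereal \<bar>h y\<bar> \<le> ?e" by blast
  moreover have "?e < \<infinity>" using h by (simp add: Linf_space_def)
  ultimately have "\<bar>h y\<bar> \<le> Linf_norm M h" unfolding Linf_norm_def by (cases ?e) auto
  thus thesis using that y(1) by blast
qed

text \<open>The test function \<open>|x|\<^bsup>-(\<alpha>+1)/q\<^esup>\<close>, cut off to finitely many spheres, gives each of them the same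
  contribution to the norm.\<close>

lemma H_bounded_test:
  fixes q lam mu nu alpha c :: real
  assumes M: "normalized_haar_measure (M :: 'p::prime_card padic measure)"
    and q: "1 < q"
    and bd: "H_bounded M lam mu nu (Lq_space M q alpha) (Lq_norm M q alpha) (Linf_space M) (Linf_norm M)"
  defines "c \<equiv> 1 - 1 / real CARD('p)"
  obtains C where "\<And>(A :: int set) (m :: int). finite A \<Longrightarrow>
    (\<Sum>k\<in>A. c * real CARD('p) powr (k * (mu + 1 - (alpha + 1) / q) + m * nu - lam * max k m))
      \<le> C * (c * card A) powr (1 / q)"
proof -
  let ?P = "real CARD('p)"
  have P: "?P > 1" by (rule CARD_prime_gt_1)
  obtain C where C: "\<And>f. f \<in> Lq_space M q alpha \<Longrightarrow> H_op M lam mu nu f \<in> Linf_space M"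
    "\<And>f. f \<in> Lq_space M q alpha \<Longrightarrow> Linf_norm M (H_op M lam mu nu f) \<le> C * Lq_norm M q alpha f"
    using bd unfolding H_bounded_def by blast
  have "(\<Sum>k\<in>A. c * ?P powr (k * (mu + 1 - (alpha + 1) / q) + m * nu - lam * max k m))
      \<le> C * (c * card A) powr (1 / q)" if A: "finite A" for A and m :: int
  proof -
    define f where "f x = (if padic_log x \<in> A then ?P powr (- padic_log x * ((alpha + 1) / q)) else 0)"
      for x :: "'p padic"
    have f_meas: "f \<in> borel_measurable (punctured M)"
      unfolding f_def[abs_def] by (rule measurable_punctured[OF M]) measurable
    have fq: "\<bar>f x\<bar> powr q * padic_norm x powr alpha = (if padic_log x \<in> A then ?P powr (- padic_log x) else 0)"
      if "x \<in> space (punctured M)" for x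
    proof -
      have "padic_norm x = ?P powr padic_log x"
        using that by (intro padic_norm_eq_powr_log) (simp add: space_punctured[OF M])
      hence "\<bar>f x\<bar> powr q * padic_norm x powr alpha = (if padic_log x \<in> A
          then ?P powr (- padic_log x * ((alpha + 1) / q) * q + padic_log x * alpha) else 0)"
        by (simp add: f_def powr_powr flip: powr_add)
      moreover have "- padic_log x * ((alpha + 1) / q) * q + padic_log x * alpha = - padic_log x"
        using q by (simp add: field_simps)
      ultimately show ?thesis by simp
    qed
    have "has_bochner_integral (punctured M) (\<lambda>x. if padic_log x \<in> A then ?P powr (- padic_log x) else 0)
        (\<Sum>k\<in>A. c * ?P powr k * (if k \<in> A then ?P powr (- k) else 0))"
      unfolding c_def by (rule has_bochner_integral_padic_log_finite[OF M A]) auto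
    also have "(\<Sum>k\<in>A. c * ?P powr k * (if k \<in> A then ?P powr (- k) else 0)) = c * card A"
      using P by (simp add: mult.assoc flip: powr_add)
    finally have f_int: "has_bochner_integral (punctured M) (\<lambda>x. \<bar>f x\<bar> powr q * padic_norm x powr alpha) (c * card A)"
      using fq by (simp cong: has_bochner_integral_cong)
    have f: "f \<in> Lq_space M q alpha"
      using f_meas f_int by (auto simp: Lq_space_def dest: integrable.intros)
    have f_norm: "Lq_norm M q alpha f = (c * card A) powr (1 / q)"
      unfolding Lq_norm_def has_bochner_integral_integral_eq[OF f_int] ..
    obtain y where y: "y \<in> padic_sphere m" "\<bar>H_op M lam mu nu f y\<bar> \<le> Linf_norm M (H_op M lam mu nu f)"
      by (rule abs_le_Linf_norm_on_sphere[OF M C(1)[OF f]])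
    have y0: "y \<noteq> 0" "padic_log y = m" using y(1) P by (auto simp: padic_sphere_def padic_log_eq)
    \<comment> \<open>Kernel times test function on the sphere |x| = p^k. The sphere weight p^k
      later adds 1 to the coefficient of k in the exponent.\<close>
    let ?g = "\<lambda>k::int. if k \<in> A then ?P powr (k * mu + m * nu - lam * max k m - k * ((alpha + 1) / q)) else 0"
    have "has_bochner_integral (punctured M) (\<lambda>x. ?g (padic_log x)) (\<Sum>k\<in>A. c * ?P powr k * ?g k)"
      unfolding c_def by (rule has_bochner_integral_padic_log_finite[OF M A]) auto
    moreover have "H_kernel lam mu nu x y * f x = ?g (padic_log x)" if "x \<in> space (punctured M)" for x
      using that y0 by (simp add: space_punctured[OF M] H_kernel_eq_powr f_def powr_diff powr_minus divide_inverse)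
    ultimately have "has_bochner_integral (punctured M) (\<lambda>x. H_kernel lam mu nu x y * f x) (\<Sum>k\<in>A. c * ?P powr k * ?g k)"
      by (simp cong: has_bochner_integral_cong)
    hence "H_op M lam mu nu f y = (\<Sum>k\<in>A. c * ?P powr k * ?g k)"
      unfolding H_op_def by (rule has_bochner_integral_integral_eq)
    also have "\<dots> = (\<Sum>k\<in>A. c * ?P powr (k * (mu + 1 - (alpha + 1) / q) + m * nu - lam * max k m))"
      by (intro sum.cong refl) (simp add: mult.assoc algebra_simps flip: powr_add)
    finally show ?thesis
      using y(2) C(2)[OF f, unfolded f_norm] by linarith
  qed
  thus thesis using that by blast
qed

lemma H_bounded_Linf_necessary:
  fixes q lam mu nu alpha :: real
  assumes M: "normalized_haar_measure (M :: 'p::prime_card padic measure)"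
    and q: "1 < q"
    and bd: "H_bounded M lam mu nu (Lq_space M q alpha) (Lq_norm M q alpha) (Linf_space M) (Linf_norm M)"
  shows "lam = mu + nu + 1 - (alpha + 1) / q" "0 < nu" "nu < lam"
proof -
  let ?P = "real CARD('p)"
  have P: "?P > 1" by (rule CARD_prime_gt_1)
  define c where "c = 1 - 1 / ?P"
  have c: "c > 0" using P by (simp add: c_def)
  \<comment> \<open>The homogeneity relation reads t + \<nu> = \<lambda>. For m = 0 the exponent in
    the test sum is kt when k \<le> 0 and k(t-\<lambda>) when k \<ge> 0; under homogeneity t =
    \<lambda>-\<nu> and t-\<lambda> = -\<nu>.\<close>
  define t where "t = mu + 1 - (alpha + 1) / q"
  obtain C where C: "\<And>(A :: int set) (m :: int). finite A \<Longrightarrow>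
      (\<Sum>k\<in>A. c * ?P powr (k * t + m * nu - lam * max k m)) \<le> C * (c * card A) powr (1 / q)"
    unfolding c_def t_def by (rule H_bounded_test[OF M q bd]) blast
  show hom: "lam = mu + nu + 1 - (alpha + 1) / q"
  proof (rule ccontr)
    assume "\<not> ?thesis"
    hence e: "t + nu - lam \<noteq> 0" by (auto simp: t_def)
    \<comment> \<open>With k = m = sn the sum has one term of exponent n|t+\<nu>-\<lambda>|,
      unbounded in n, while the right side stays fixed.\<close>
    define s :: int where "s = (if t + nu - lam > 0 then 1 else - 1)"
    have "?P powr \<bar>t + nu - lam\<bar> > 1" using P e by simp
    then obtain n where n: "C * c powr (1 / q) / c < (?P powr \<bar>t + nu - lam\<bar>) ^ n"
      using real_arch_pow by blast
    have "c * ?P powr ((s * n) * t + (s * n) * nu - lam * (s * n)) \<le> C * c powr (1 / q)"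
      using C[of "{s * int n}" "s * int n"] by simp
    also have "(s * n) * t + (s * n) * nu - lam * (s * n) = s * (t + nu - lam) * n"
      by (simp add: algebra_simps)
    also have "s * (t + nu - lam) = \<bar>t + nu - lam\<bar>" by (simp add: s_def)
    also have "?P powr (\<bar>t + nu - lam\<bar> * n) = (?P powr \<bar>t + nu - lam\<bar>) ^ n"
      using P by (simp add: powr_realpow flip: powr_powr)
    finally show False using n c by (simp add: divide_less_eq mult.commute)
  qed
  \<comment> \<open>Linear growth in the number N of spheres beats N^(1/q) because q > 1: the
    quotient is (cN)^(1-1/q), which tends to infinity.\<close>
  have growth: "\<not> (\<forall>N. c * real N \<le> C * (c * real N) powr (1 / q))"
  proof
    assume le: "\<forall>N. c * real N \<le> C * (c * real N) powr (1 / q)"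
    have "filterlim (\<lambda>N. (c * real N) powr (1 - 1 / q)) at_top sequentially"
      using q c by real_asymp
    hence "eventually (\<lambda>N. (c * real N) powr (1 - 1 / q) > C) sequentially"
      by (simp add: filterlim_at_top_dense)
    hence "eventually (\<lambda>N. (c * real N) powr (1 - 1 / q) > C \<and> N > 0) sequentially"
      using eventually_gt_at_top by (rule eventually_conj)
    then obtain N where N: "(c * real N) powr (1 - 1 / q) > C" "N > 0"
      by (auto simp: eventually_sequentially)
    have "C * (c * real N) powr (1 / q) < (c * real N) powr (1 - 1 / q) * (c * real N) powr (1 / q)"
      using N c by (intro mult_strict_right_mono) auto
    also have "\<dots> = c * real N" using N c by (simp flip: powr_add)
    finally show False using le[rule_format, of N] by simp
  qed
  show "0 < nu"
  proof (rule ccontr)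
    assume "\<not> 0 < nu"
    hence e: "t - lam \<ge> 0" using hom by (simp add: t_def)
    have "c * real N \<le> C * (c * real N) powr (1 / q)" for N
    proof -
      \<comment> \<open>With y on the unit sphere, each of the N spheres outside it contributes at
        least c if \<nu> \<le> 0.\<close>
      have "(\<Sum>k\<in>{1..int N}. c * 1) \<le> (\<Sum>k\<in>{1..int N}. c * ?P powr (k * t + (0::int) * nu - lam * max k 0))"
      proof (intro sum_mono mult_left_mono)
        fix k assume "k \<in> {1..int N}"
        hence "k * t + (0::int) * nu - lam * max k 0 = k * (t - lam)" "real_of_int k * (t - lam) \<ge> 0"
          using e by (auto simp: algebra_simps)
        thus "1 \<le> ?P powr (k * t + (0::int) * nu - lam * max k 0)" using P by (simp add: ge_one_powr_ge_zero)
      qed (use c in simp)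
      also have "\<dots> \<le> C * (c * card {1..int N}) powr (1 / q)" by (rule C) simp
      finally show ?thesis by (simp add: mult.commute)
    qed
    thus False using growth by blast
  qed
  show "nu < lam"
  proof (rule ccontr)
    assume "\<not> nu < lam"
    hence e: "t \<le> 0" using hom by (simp add: t_def)
    have "c * real N \<le> C * (c * real N) powr (1 / q)" for N
    proof -
      \<comment> \<open>Here the N spheres lie inside the unit sphere: \<open>max k 0\<close> is 0,
        and kt is a product of two nonpositive numbers.\<close>
      have "(\<Sum>k\<in>{- int N..-1}. c * 1) \<le> (\<Sum>k\<in>{- int N..-1}. c * ?P powr (k * t + (0::int) * nu - lam * max k 0))"
      proof (intro sum_mono mult_left_mono)
        fix k assume "k \<in> {- int N..-1}"
        hence "k * t + (0::int) * nu - lam * max k 0 \<ge> 0"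
          using e by (simp add: max_def mult_nonpos_nonpos)
        thus "1 \<le> ?P powr (k * t + (0::int) * nu - lam * max k 0)"
          using P by (intro ge_one_powr_ge_zero) auto
      qed (use c in simp)
      also have "\<dots> \<le> C * (c * card {- int N..-1}) powr (1 / q)" by (rule C) simp
      finally show ?thesis by (simp add: mult.commute)
    qed
    thus False using growth by blast
  qed
qed

theorem theorem1p5:
  fixes M :: "'p::prime_card padic measure"
    and q lam mu nu alpha :: real
  assumes "normalized_haar_measure M"
    and "1 < q"
  shows "(H_bounded M lam mu nu (Lq_space M q alpha) (Lq_norm M q alpha) (Linf_space M) (Linf_norm M)
      \<longleftrightarrow> lam = mu + nu + 1 - (alpha + 1) / q \<and> q * (mu + 1 - lam) < alpha + 1 \<and> alpha + 1 < q * (mu + 1))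
    \<and> (H_bounded M lam mu nu (Lq_space M q alpha) (Lq_norm M q alpha) (Linf_space M) (Linf_norm M)
      \<longleftrightarrow> lam = mu + nu + 1 - (alpha + 1) / q \<and> 0 < nu \<and> nu < lam)"
proof -
  let ?bd = "H_bounded M lam mu nu (Lq_space M q alpha) (Lq_norm M q alpha) (Linf_space M) (Linf_norm M)"
  have iff: "?bd \<longleftrightarrow> lam = mu + nu + 1 - (alpha + 1) / q \<and> 0 < nu \<and> nu < lam"
  proof
    assume ?bd
    thus "lam = mu + nu + 1 - (alpha + 1) / q \<and> 0 < nu \<and> nu < lam"
      by (intro conjI H_bounded_Linf_necessary[OF assms])
  next
    assume "lam = mu + nu + 1 - (alpha + 1) / q \<and> 0 < nu \<and> nu < lam"
    thus ?bd by (intro H_bounded_Linf_sufficient[OF assms]) auto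
  qed
  \<comment> \<open>After division by q > 0, homogeneity turns \<mu>+1-\<lambda> < (\<alpha>+1)/q
    into 0 < \<nu>, and (\<alpha>+1)/q < \<mu>+1 into \<nu> < \<lambda>.\<close>
  have "q * u < alpha + 1 \<longleftrightarrow> u < (alpha + 1) / q" "alpha + 1 < q * u \<longleftrightarrow> (alpha + 1) / q < u" for u
    using assms(2) by (simp_all add: less_divide_eq divide_less_eq mult.commute)
  thus ?thesis unfolding iff by auto
qed

end
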